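(* Let $X$ be a complex Banach space and let $\tau:\mathcal{D}\to\mathcal{D}$ be a permutation (bijection) such that $|\tau(I)|=|I|$ for all $I\in\mathcal{D}$. Then, for $1<q<p<2$, the boundedness of $$\mathrm{Id}_X\otimes T_\tau: L^p_{X,0}\to L^p_X$$ implies the boundedness of $\mathrm{Id}_X\otimes T_\tau: L^q_{X,0}\to L^q_X$.
   Context: $\mathcal{D}$ is the set of all dyadic intervals contained in $[0,1)$ (intervals $[j2^{-k},(j+1)2^{-k})$, $k\ge 0$, $0\le j<2^k$); $|I|$ denotes Lebesgue measure. $h_I$ is the $L_\infty$-normalized Haar function supported on $I$ ($+1$ on the left half of $I$, $-1$ on the right half, $0$ elsewhere). All Banach spaces have dimension at least one. $L^p_X=L^p_X([0,1))$ is the Bochner space with Lebesgue measure and $L^p_{X,0}$ its subspace of mean zero functions. For an injective map $\tau:\mathcal{D}\to\mathcal{D}$ with $|\tau(I)|=|I|$ and a Banach space $X$, the rearrangement operator $\mathrm{Id}_X\otimes T_\tau$ maps $\sum_I a_I h_I$ to $\sum_I a_I h_{\tau(I)}$ for finitely supported $(a_I)_{I\in\mathcal{D}}\subseteq X$. It is called bounded from $L^p_{X,0}$ to $L^p_X$ if $$\sup\Big\{\Big\|\sum_{I} a_I h_{\tau(I)}\Big\|_{L^p_X}:\Big\|\sum_I a_I h_I\Big\|_{L^p_X}\le 1\Big\}<\infty,$$ the supremum being over finitely supported families $(a_I)\subseteq X$. *)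

theory Defs
  imports "HOL-Analysis.Analysis"
begin

text \<open>
  The real scalar multiplication and the norm come from the library class of real Banach spaces;
  the complex scalar multiplication extends the former and is compatible with the latter.
\<close>

class complex_banach = banach +
  fixes scaleC :: "complex \<Rightarrow> 'a \<Rightarrow> 'a"
  assumes scaleC_add_right: "scaleC c (x + y) = scaleC c x + scaleC c y"
    and scaleC_add_left: "scaleC (c + d) x = scaleC c x + scaleC d x"
    and scaleC_scaleC: "scaleC c (scaleC d x) = scaleC (c * d) x"
    and scaleC_one: "scaleC 1 x = x"
    and scaleC_of_real: "scaleC (complex_of_real r) x = r *\<^sub>R x"
    and norm_scaleC: "norm (scaleC c x) = cmod c * norm x"

instantiation complex :: complex_banach
begin

definition scaleC_complex :: "complex \<Rightarrow> complex \<Rightarrow> complex"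
  where "scaleC_complex c x = c * x"

instance
  by standard (simp_all add: scaleC_complex_def algebra_simps norm_mult scaleR_conv_of_real)

end

definition dyadic_intervals :: "real set set"
  where "dyadic_intervals =
    {{real j / 2 ^ k ..< real (j + 1) / 2 ^ k} | j k :: nat. j < 2 ^ k}"

text \<open>Only meaningful for half-open intervals \<open>I = {a..<b}\<close>, where \<open>Inf I = a\<close> and \<open>Sup I = b\<close>.\<close>

definition haar :: "real set \<Rightarrow> real \<Rightarrow> real"
  where "haar I x =
    (if x \<in> I then (if x < (Inf I + Sup I) / 2 then 1 else - 1) else 0)"

text \<open>
  The norm of \<open>L\<^sup>p\<^sub>X([0,1))\<close>. It is only applied to finite linear combinations of Haar functions,
  for which the integrand is integrable, see \<open>integrable_haar_sum\<close> and
  \<open>integrable_rearranged_haar_sum\<close> below.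
\<close>

definition Lp_norm :: "real \<Rightarrow> (real \<Rightarrow> 'a::banach) \<Rightarrow> real"
  where "Lp_norm p f =
    (integral\<^sup>L (lebesgue_on {0..<1}) (\<lambda>x. norm (f x) powr p)) powr (1 / p)"

definition finitely_supported :: "(real set \<Rightarrow> 'a::zero) \<Rightarrow> bool"
  where "finitely_supported a \<longleftrightarrow> finite {I \<in> dyadic_intervals. a I \<noteq> 0}"

text \<open>
  \<open>haar_sum a\<close> is the function \<open>\<Sum>\<^sub>I a\<^sub>I h\<^sub>I\<close>, and \<open>rearranged_haar_sum \<tau> a\<close> is its image
  \<open>\<Sum>\<^sub>I a\<^sub>I h\<^bsub>\<tau>(I)\<^esub>\<close> under \<open>Id\<^sub>X \<otimes> T\<^sub>\<tau>\<close>. Values of \<open>a\<close> outside the dyadic intervals are ignored.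
\<close>

definition rearranged_haar_sum ::
    "(real set \<Rightarrow> real set) \<Rightarrow> (real set \<Rightarrow> 'a::banach) \<Rightarrow> real \<Rightarrow> 'a"
  where "rearranged_haar_sum \<tau> a x =
    (\<Sum>I | I \<in> dyadic_intervals \<and> a I \<noteq> 0. haar (\<tau> I) x *\<^sub>R a I)"

definition haar_sum :: "(real set \<Rightarrow> 'a::banach) \<Rightarrow> real \<Rightarrow> 'a"
  where "haar_sum a x = (\<Sum>I | I \<in> dyadic_intervals \<and> a I \<noteq> 0. haar I x *\<^sub>R a I)"

text \<open>
  Boundedness of \<open>Id\<^sub>X \<otimes> T\<^sub>\<tau>\<close> from \<open>L\<^sup>p\<^bsub>X,0\<^esub>\<close> to \<open>L\<^sup>p\<^sub>X\<close>; the phantom argument determines the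
  Banach space \<open>X\<close>, which does not occur in the types of \<open>\<tau>\<close> and \<open>p\<close>.
\<close>

definition bounded_rearrangement ::
    "'a::banach itself \<Rightarrow> (real set \<Rightarrow> real set) \<Rightarrow> real \<Rightarrow> bool"
  where "bounded_rearrangement X \<tau> p \<longleftrightarrow>
    (SUP a \<in> {a :: real set \<Rightarrow> 'a. finitely_supported a \<and> Lp_norm p (haar_sum a) \<le> 1}.
      ennreal (Lp_norm p (rearranged_haar_sum \<tau> a))) < \<infinity>"

lemma haar_dyadic:
  assumes "I \<in> dyadic_intervals"
  obtains a b where "a < b" "I = {a..<b}"
    "haar I = (\<lambda>x. indicat_real {a..<(a + b) / 2} x - indicat_real {(a + b) / 2..<b} x)"
proof -
  from assms obtain j k :: nat where I: "I = {real j / 2 ^ k ..< real (j + 1) / 2 ^ k}"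
    unfolding dyadic_intervals_def by blast
  define a b where "a = real j / 2 ^ k" and "b = real (j + 1) / 2 ^ k"
  have ab: "a < b" and I: "I = {a..<b}"
    by (auto simp: a_def b_def I divide_strict_right_mono)
  have "haar I x = indicat_real {a..<(a + b) / 2} x - indicat_real {(a + b) / 2..<b} x" for x
    using ab unfolding haar_def I by (auto simp: indicator_def)
  with ab I that show ?thesis by blast
qed

lemma simple_function_haar:
  assumes "I \<in> dyadic_intervals"
  shows "simple_function (lebesgue_on {0..<1}) (haar I)"
proof -
  obtain a b where h: "haar I = (\<lambda>x. indicat_real {a..<(a + b) / 2} x - indicat_real {(a + b) / 2..<b} x)"
    using assms by (rule haar_dyadic)
  have "haar I \<in> borel_measurable borel"
    unfolding h by simp
  then have "haar I \<in> borel_measurable (lebesgue_on {0..<1})"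
    by (intro measurable_restrict_space1 measurable_completion) simp
  moreover have "finite (haar I ` space (lebesgue_on {0..<1}))"
    by (rule finite_subset[of _ "{0, 1, - 1}"]) (auto simp: haar_def)
  ultimately show ?thesis
    by (intro simple_function_borel_measurable)
qed

lemma integrable_rearranged_haar_sum:
  fixes a :: "real set \<Rightarrow> 'a::banach"
  assumes "finitely_supported a" and "\<And>I. I \<in> dyadic_intervals \<Longrightarrow> \<tau> I \<in> dyadic_intervals"
    and p: "p > 0"
  shows "integrable (lebesgue_on {0..<1}) (\<lambda>x. norm (rearranged_haar_sum \<tau> a x) powr p)"
proof (rule finite_measure.integrable_const_bound)
  define F where "F = {I \<in> dyadic_intervals. a I \<noteq> 0}"
  show "finite_measure (lebesgue_on {0..<1::real})"
    by (intro finite_measure_lebesgue_on bounded_set_imp_lmeasurable) auto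
  have "norm (rearranged_haar_sum \<tau> a x) \<le> (\<Sum>I\<in>F. norm (a I))" for x
    unfolding rearranged_haar_sum_def F_def[symmetric]
    by (rule sum_norm_le) (auto simp: haar_def)
  then show "AE x in lebesgue_on {0..<1}.
      norm (norm (rearranged_haar_sum \<tau> a x) powr p) \<le> (\<Sum>I\<in>F. norm (a I)) powr p"
    using p by (auto intro!: powr_mono2)
  have "simple_function (lebesgue_on {0..<1}) (\<lambda>x. haar (\<tau> I) x *\<^sub>R a I)" if "I \<in> F" for I
    using that assms(2)
    by (intro simple_function_compose1[of _ _ "\<lambda>c. c *\<^sub>R a I"] simple_function_haar)
      (auto simp: F_def)
  then have "simple_function (lebesgue_on {0..<1}) (\<lambda>x. \<Sum>I\<in>F. haar (\<tau> I) x *\<^sub>R a I)"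
    by (rule simple_function_sum)
  then have "simple_function (lebesgue_on {0..<1})
      (\<lambda>x. norm (\<Sum>I\<in>F. haar (\<tau> I) x *\<^sub>R a I) powr p)"
    by (rule simple_function_compose1)
  then show "(\<lambda>x. norm (rearranged_haar_sum \<tau> a x) powr p)
      \<in> borel_measurable (lebesgue_on {0..<1})"
    unfolding rearranged_haar_sum_def F_def[symmetric]
    by (rule borel_measurable_simple_function)
qed

corollary integrable_haar_sum:
  fixes a :: "real set \<Rightarrow> 'a::banach"
  assumes "finitely_supported a" and "p > 0"
  shows "integrable (lebesgue_on {0..<1}) (\<lambda>x. norm (haar_sum a x) powr p)"
  using integrable_rearranged_haar_sum[of a "\<lambda>I. I" p] assms
  by (simp add: haar_sum_def rearranged_haar_sum_def)

end

theory Submission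
  imports Defs
begin

text \<open>
  Write \<open>f = \<Sum>\<^sub>I a\<^sub>I h\<^sub>I\<close> for a finite Haar sum, \<open>T f = \<Sum>\<^sub>I a\<^sub>I h\<^bsub>\<tau>(I)\<^esub>\<close>, and let \<open>m\<close> be the dyadic
  maximal function of \<open>\<parallel>f\<parallel>\<close>. The proof is a Calderon-Zygmund argument with the dyadic martingale:
  at each height \<open>t\<close> the function \<open>f\<close> is split, the measure of \<open>{\<parallel>T f\<parallel> > t}\<close> is estimated by the
  level sets of \<open>m\<close>, and the estimate is integrated over \<open>t\<close>.

  Fix \<open>t\<close> and call \<open>I\<close> bad if it lies in a dyadic interval over which the average of \<open>\<parallel>f\<parallel>\<close>
  exceeds \<open>t\<close>. The terms with \<open>I\<close> not bad form a stopped martingale \<open>g\<close>, and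
  \<open>\<parallel>g\<parallel> \<le> min (2 t) m\<close> (\<open>norm_good_part_le\<close>); boundedness on \<open>L\<^sup>p\<close> and Chebyshev's inequality control
  \<open>T g\<close>. The bad intervals fill only a part of \<open>{m > t}\<close>, and the image of the bad terms lives on
  the union of the intervals \<open>\<tau>(I)\<close> with \<open>I\<close> bad.

  That this union has measure at most \<open>C |{m > t}|\<close> is where \<open>p < 2\<close> enters
  (\<open>emeasure_Union_image_le\<close>). Given a finite family, keep a subfamily \<open>B\<close> whose images are disjoint
  with the same union, and test the operator on \<open>s = \<Sum>\<^bsub>I\<in>B\<^esub> h\<^sub>I\<close>, times a unit vector. On the image
  side \<open>\<parallel>T s\<parallel>\<^sub>p\<^sup>p\<close> is the measure of the union of the images, and by orthogonality this is also
  \<open>\<parallel>s\<parallel>\<^sub>2\<^sup>2\<close>. On the other side \<open>s\<close> is supported in the union \<open>U\<close> of \<open>B\<close>, so \<open>\<parallel>s\<parallel>\<^sub>p\<^sup>p\<close> is at most a small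
  multiple of \<open>\<parallel>s\<parallel>\<^sub>2\<^sup>2\<close> plus a large multiple of \<open>|U|\<close>, and the former can be absorbed.

  Integrating the distributional inequality (\<open>rearranged_haar_sum_distribution_le\<close>) against
  \<open>q t\<^bsup>q-1\<^esup>\<close> bounds \<open>\<parallel>T f\<parallel>\<^sub>q\<close> by \<open>\<parallel>m\<parallel>\<^sub>q\<close>, because \<open>q < p\<close>
  (\<open>nn_integral_powr_le_of_distribution_bound\<close>), and Doob's inequality bounds \<open>\<parallel>m\<parallel>\<^sub>q\<close> by \<open>\<parallel>f\<parallel>\<^sub>q\<close>,
  because \<open>q > 1\<close> (\<open>dyadic_maximal_powr_integral_le\<close>).
\<close>

section \<open>Layer-cake formulas and real interpolation\<close>

text \<open>
  For \<open>r < 1\<close> the integrand is unbounded at \<open>0\<close>, so the fundamental theorem of calculus is applied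
  on the open interval, with the limits of \<open>t\<^sup>r\<close> at its two ends.
\<close>

lemma set_nn_integral_powr_layer:
  fixes m r :: real
  assumes "m \<ge> 0" "r > 0"
  shows "(\<integral>\<^sup>+ t\<in>{0<..<m}. ennreal (r * t powr (r - 1)) \<partial>lborel) = ennreal (m powr r)"
proof (cases "m = 0")
  case False
  then have m: "m > 0" using assms by simp
  have lim0: "(((\<lambda>t. t powr r) \<circ> real_of_ereal) \<longlongrightarrow> 0) (at_right (ereal 0))"
    unfolding ereal_tendsto_simps1 using assms(2)
    by (auto intro!: tendsto_eq_intros eventually_at_rightI[of 0 1])
  have limm: "(((\<lambda>t. t powr r) \<circ> real_of_ereal) \<longlongrightarrow> m powr r) (at_left (ereal m))"
    unfolding ereal_tendsto_simps1 using m by (auto intro!: tendsto_eq_intros)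
  have *: "set_integrable lborel (einterval (ereal 0) (ereal m)) (\<lambda>t. r * t powr (r - 1)) \<and>
    (LBINT t=ereal 0..ereal m. r * t powr (r - 1)) = m powr r - 0"
    by (intro conjI interval_integral_FTC_nonneg[where F="\<lambda>t. t powr r", OF _ _ _ _ lim0 limm])
      (use m assms(2) in \<open>auto intro!: derivative_eq_intros continuous_intros AE_I2\<close>)
  have ei: "einterval (ereal 0) (ereal m) = {0<..<m}" by (auto simp: einterval_def)
  have "(\<integral>\<^sup>+ t\<in>{0<..<m}. ennreal (r * t powr (r - 1)) \<partial>lborel)
      = (\<integral>\<^sup>+ t. ennreal (indicator {0<..<m} t *\<^sub>R (r * t powr (r - 1))) \<partial>lborel)"
    by (intro nn_integral_cong) (auto split: split_indicator)
  also have "\<dots> = ennreal (\<integral>t. indicator {0<..<m} t *\<^sub>R (r * t powr (r - 1)) \<partial>lborel)"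
    using * assms m unfolding ei set_integrable_def by (intro nn_integral_eq_integral) (auto split: split_indicator)
  also have "\<dots> = ennreal (m powr r)"
    using * m by (simp add: interval_lebesgue_integral_def set_lebesgue_integral_def ei mult.left_commute)
  finally show ?thesis .
qed simp

lemma set_nn_integral_powr_tail:
  fixes m s :: real
  assumes "m > 0" "s > 0"
  shows "(\<integral>\<^sup>+ t\<in>{m..}. ennreal (t powr (- s - 1)) \<partial>lborel) = ennreal (m powr (- s) / s)"
proof -
  have "((\<lambda>t::real. - (t powr (- s) / s)) \<longlongrightarrow> - (0 / s)) at_top"
    using assms(2) by (intro tendsto_intros tendsto_neg_powr filterlim_ident) auto
  then have "(\<integral>\<^sup>+ t. ennreal (t powr (- s - 1)) * indicator {m..} t \<partial>lborel)
      = ennreal (- (0 / s) - - (m powr (- s) / s))"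
    using assms
    by (intro nn_integral_FTC_atLeast) (auto intro!: derivative_eq_intros)
  then show ?thesis by simp
qed

text \<open>
  Tonelli's theorem after writing \<open>u\<^sup>r\<close> as the integral of \<open>r t\<^bsup>r-1\<^esup>\<close> over \<open>0 < t < u\<close>. The weight
  serves the maximal inequality, where the level sets of one function carry the mass of another.
\<close>

lemma (in sigma_finite_measure) nn_integral_layer_cake:
  fixes u :: "'a \<Rightarrow> real" and w :: "'a \<Rightarrow> ennreal"
  assumes [measurable]: "u \<in> borel_measurable M" "w \<in> borel_measurable M"
    and u: "\<And>x. x \<in> space M \<Longrightarrow> u x \<ge> 0" and r: "r > 0"
  shows "(\<integral>\<^sup>+ x. w x * ennreal (u x powr r) \<partial>M)
    = (\<integral>\<^sup>+ t\<in>{0<..}. ennreal (r * t powr (r - 1)) * (\<integral>\<^sup>+ x\<in>{x. t < u x}. w x \<partial>M) \<partial>lborel)"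
proof -
  interpret L: pair_sigma_finite lborel M ..
  have "(\<integral>\<^sup>+ x. w x * ennreal (u x powr r) \<partial>M)
      = (\<integral>\<^sup>+ x. (\<integral>\<^sup>+ t. w x * (ennreal (r * t powr (r - 1)) * indicator {0<..} t * (if t < u x then 1 else 0)) \<partial>lborel) \<partial>M)"
  proof (intro nn_integral_cong)
    fix x assume "x \<in> space M"
    then have "ennreal (u x powr r) = (\<integral>\<^sup>+ t\<in>{0<..<u x}. ennreal (r * t powr (r - 1)) \<partial>lborel)"
      using u r by (simp add: set_nn_integral_powr_layer)
    also have "\<dots> = (\<integral>\<^sup>+ t. ennreal (r * t powr (r - 1)) * indicator {0<..} t * (if t < u x then 1 else 0) \<partial>lborel)"
      by (intro nn_integral_cong) (auto split: split_indicator)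
    finally show "w x * ennreal (u x powr r) =
        (\<integral>\<^sup>+ t. w x * (ennreal (r * t powr (r - 1)) * indicator {0<..} t * (if t < u x then 1 else 0)) \<partial>lborel)"
      by (simp add: nn_integral_cmult)
  qed
  also have "\<dots> = (\<integral>\<^sup>+ t. (\<integral>\<^sup>+ x. w x * (ennreal (r * t powr (r - 1)) * indicator {0<..} t * (if t < u x then 1 else 0)) \<partial>M) \<partial>lborel)"
    by (rule L.Fubini') measurable
  also have "\<dots> = (\<integral>\<^sup>+ t\<in>{0<..}. ennreal (r * t powr (r - 1)) * (\<integral>\<^sup>+ x\<in>{x. t < u x}. w x \<partial>M) \<partial>lborel)"
  proof (intro nn_integral_cong)
    fix t :: real
    have "(\<integral>\<^sup>+ x. w x * (ennreal (r * t powr (r - 1)) * indicator {0<..} t * (if t < u x then 1 else 0)) \<partial>M)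
      = (\<integral>\<^sup>+ x. (ennreal (r * t powr (r - 1)) * indicator {0<..} t) * (w x * indicator {x. t < u x} x) \<partial>M)"
      by (intro nn_integral_cong) (auto split: split_indicator simp: mult_ac)
    also have "\<dots> = (ennreal (r * t powr (r - 1)) * indicator {0<..} t) * (\<integral>\<^sup>+ x\<in>{x. t < u x}. w x \<partial>M)"
      by (rule nn_integral_cmult) measurable
    finally show "(\<integral>\<^sup>+ x. w x * (ennreal (r * t powr (r - 1)) * indicator {0<..} t * (if t < u x then 1 else 0)) \<partial>M)
      = ennreal (r * t powr (r - 1)) * (\<integral>\<^sup>+ x\<in>{x. t < u x}. w x \<partial>M) * indicator {0<..} t"
      by (simp add: mult_ac)
  qed
  finally show ?thesis .
qed

lemma (in sigma_finite_measure) nn_integral_powr_eq_superlevel: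
  fixes u :: "'a \<Rightarrow> real"
  assumes [measurable]: "u \<in> borel_measurable M"
    and u: "\<And>x. x \<in> space M \<Longrightarrow> u x \<ge> 0" and r: "r > 0"
  shows "(\<integral>\<^sup>+ x. ennreal (u x powr r) \<partial>M)
    = (\<integral>\<^sup>+ t\<in>{0<..}. ennreal (r * t powr (r - 1)) * emeasure M {x\<in>space M. t < u x} \<partial>lborel)"
proof -
  have *: "(\<integral>\<^sup>+ x\<in>{x. t < u x}. 1 \<partial>M) = emeasure M {x\<in>space M. t < u x}" for t
  proof -
    have "(\<integral>\<^sup>+ x\<in>{x. t < u x}. 1 \<partial>M) = (\<integral>\<^sup>+ x. indicator {x\<in>space M. t < u x} x \<partial>M)"
      by (intro nn_integral_cong) (auto split: split_indicator)
    then show ?thesis by simp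
  qed
  show ?thesis
    using nn_integral_layer_cake[of u "\<lambda>_. 1" r] u r by (simp only: *) simp
qed

text \<open>
  The hypothesis on the level sets is what splitting a function at height \<open>t\<close> yields: strong type
  \<open>p\<close> applied to the part below \<open>t\<close>, and a bound on the support of the rest. At a fixed point the
  last term of the hypothesis contributes \<open>v\<^sup>p\<close> times the integral of \<open>q t\<^bsup>q-1-p\<^esup>\<close> over \<open>t \<ge> v\<close>. The
  integral converges because \<open>q < p\<close>, and the contribution is \<open>q / (p - q)\<close> times \<open>v\<^sup>q\<close>.
\<close>

lemma (in sigma_finite_measure) nn_integral_powr_le_of_distribution_bound:
  fixes u v :: "'a \<Rightarrow> real" and C K p q :: real
  assumes [measurable]: "u \<in> borel_measurable M" "v \<in> borel_measurable M"
    and u: "\<And>x. x \<in> space M \<Longrightarrow> u x \<ge> 0" and v: "\<And>x. x \<in> space M \<Longrightarrow> v x \<ge> 0"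
    and pq: "0 < q" "q < p" and CK: "C \<ge> 0" "K \<ge> 0"
    and dist: "\<And>t. t > 0 \<Longrightarrow> emeasure M {x\<in>space M. t < u x} \<le>
      ennreal C * emeasure M {x\<in>space M. t < v x}
      + ennreal K * (\<integral>\<^sup>+ x\<in>{x. v x \<le> t}. ennreal ((v x / t) powr p) \<partial>M)"
  shows "(\<integral>\<^sup>+ x. ennreal (u x powr q) \<partial>M)
    \<le> ennreal (C + K * (q / (p - q))) * (\<integral>\<^sup>+ x. ennreal (v x powr q) \<partial>M)"
proof -
  interpret L: pair_sigma_finite lborel M ..
  define \<phi> where "\<phi> t = ennreal (q * t powr (q - 1))" for t
  have [measurable]: "\<phi> \<in> borel_measurable borel" unfolding \<phi>_def by measurable
  let ?V = "\<integral>\<^sup>+ x. ennreal (v x powr q) \<partial>M"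
  have V: "?V = (\<integral>\<^sup>+ t\<in>{0<..}. \<phi> t * emeasure M {x\<in>space M. t < v x} \<partial>lborel)"
    unfolding \<phi>_def using v pq by (intro nn_integral_powr_eq_superlevel) auto
  have tail: "(\<integral>\<^sup>+ t. \<phi> t * indicator {0<..} t * (if v x \<le> t then ennreal ((v x / t) powr p) else 0) \<partial>lborel)
      \<le> ennreal (q / (p - q)) * ennreal (v x powr q)" if x: "x \<in> space M" for x
  proof (cases "v x = 0")
    case False
    then have vx: "v x > 0" using v[OF x] by simp
    have "(\<integral>\<^sup>+ t. \<phi> t * indicator {0<..} t * (if v x \<le> t then ennreal ((v x / t) powr p) else 0) \<partial>lborel)
       = (\<integral>\<^sup>+ t. ennreal (q * v x powr p) * (ennreal (t powr (- (p - q) - 1)) * indicator {v x..} t) \<partial>lborel)"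
    proof (intro nn_integral_cong)
      fix t :: real
      have "q * t powr (q - 1) * (v x / t) powr p = q * v x powr p * t powr (- (p - q) - 1)" if "v x \<le> t"
        using vx that pq by (simp add: powr_divide field_simps flip: powr_add)
      then show "\<phi> t * indicator {0<..} t * (if v x \<le> t then ennreal ((v x / t) powr p) else 0)
          = ennreal (q * v x powr p) * (ennreal (t powr (- (p - q) - 1)) * indicator {v x..} t)"
        using vx pq by (auto simp: \<phi>_def split: split_indicator simp flip: ennreal_mult)
    qed
    also have "\<dots> = ennreal (q * v x powr p) * ennreal (v x powr (- (p - q)) / (p - q))"
      using set_nn_integral_powr_tail[OF vx, of "p - q"] pq by (simp add: nn_integral_cmult)
    also have "\<dots> = ennreal (q / (p - q)) * ennreal (v x powr q)"
      using pq by (simp flip: ennreal_mult powr_add add: mult_ac)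
    finally show ?thesis by simp
  qed (simp cong: if_cong)
  have "(\<integral>\<^sup>+ x. ennreal (u x powr q) \<partial>M)
      = (\<integral>\<^sup>+ t\<in>{0<..}. \<phi> t * emeasure M {x\<in>space M. t < u x} \<partial>lborel)"
    unfolding \<phi>_def using u pq by (intro nn_integral_powr_eq_superlevel) auto
  also have "\<dots> \<le> (\<integral>\<^sup>+ t. ennreal C * (\<phi> t * emeasure M {x\<in>space M. t < v x} * indicator {0<..} t)
      + ennreal K * (\<integral>\<^sup>+ x. \<phi> t * indicator {0<..} t * (if v x \<le> t then ennreal ((v x / t) powr p) else 0) \<partial>M) \<partial>lborel)"
  proof (intro nn_integral_mono)
    fix t :: real
    have 1: "(\<integral>\<^sup>+ x. \<phi> t * indicator {0<..} t * (if v x \<le> t then ennreal ((v x / t) powr p) else 0) \<partial>M)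
      = \<phi> t * indicator {0<..} t * (\<integral>\<^sup>+ x\<in>{x. v x \<le> t}. ennreal ((v x / t) powr p) \<partial>M)"
      by (subst nn_integral_cmult[symmetric])
        (auto intro!: nn_integral_cong split: split_indicator)
    show "\<phi> t * emeasure M {x\<in>space M. t < u x} * indicator {0<..} t
      \<le> ennreal C * (\<phi> t * emeasure M {x\<in>space M. t < v x} * indicator {0<..} t)
      + ennreal K * (\<integral>\<^sup>+ x. \<phi> t * indicator {0<..} t * (if v x \<le> t then ennreal ((v x / t) powr p) else 0) \<partial>M)"
      unfolding 1
      using mult_left_mono[OF dist[of t], of "\<phi> t"]
      by (auto split: split_indicator simp: algebra_simps)
  qed
  also have "\<dots> = ennreal C * ?V + ennreal K *
      (\<integral>\<^sup>+ t. (\<integral>\<^sup>+ x. \<phi> t * indicator {0<..} t * (if v x \<le> t then ennreal ((v x / t) powr p) else 0) \<partial>M) \<partial>lborel)"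
    unfolding V by (subst nn_integral_add) (auto simp: nn_integral_cmult)
  also have "(\<integral>\<^sup>+ t. (\<integral>\<^sup>+ x. \<phi> t * indicator {0<..} t * (if v x \<le> t then ennreal ((v x / t) powr p) else 0) \<partial>M) \<partial>lborel)
     = (\<integral>\<^sup>+ x. (\<integral>\<^sup>+ t. \<phi> t * indicator {0<..} t * (if v x \<le> t then ennreal ((v x / t) powr p) else 0) \<partial>lborel) \<partial>M)"
    by (rule L.Fubini'[symmetric]) measurable
  also have "\<dots> \<le> (\<integral>\<^sup>+ x. ennreal (q / (p - q)) * ennreal (v x powr q) \<partial>M)"
    by (intro nn_integral_mono tail)
  also have "\<dots> = ennreal (q / (p - q)) * ?V"
    by (simp add: nn_integral_cmult)
  also have "ennreal C * ?V + ennreal K * (ennreal (q / (p - q)) * ?V) = ennreal (C + K * (q / (p - q))) * ?V"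
  proof -
    have "ennreal (C + K * (q / (p - q))) = ennreal C + ennreal K * ennreal (q / (p - q))"
      using CK pq by (subst ennreal_mult[symmetric]) (auto simp flip: ennreal_plus)
    then show ?thesis by (simp add: distrib_right mult.assoc)
  qed
  finally show ?thesis using CK by (simp add: mult_left_mono add_left_mono)
qed

text \<open>
  Doob's maximal inequality, separated from martingales. With \<open>c = q / (q - 1)\<close> the layer-cake
  formula gives \<open>\<integral> v\<^sup>q \<le> c \<integral> w v\<^bsup>q-1\<^esup>\<close>. A pointwise inequality of Young's type bounds the right-hand
  side by \<open>\<integral> v\<^sup>q / 2\<close> plus a multiple of \<open>\<integral> w\<^sup>q\<close>. The first of these is absorbed on the left, which
  requires \<open>\<integral> v\<^sup>q\<close> to be finite.
\<close>

lemma (in sigma_finite_measure) nn_integral_powr_le_of_weak_type: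
  fixes v w :: "'a \<Rightarrow> real" and q :: real
  assumes [measurable]: "v \<in> borel_measurable M" "w \<in> borel_measurable M"
    and v: "\<And>x. x \<in> space M \<Longrightarrow> v x \<ge> 0" and w: "\<And>x. x \<in> space M \<Longrightarrow> w x \<ge> 0"
    and q: "q > 1" and fin: "(\<integral>\<^sup>+ x. ennreal (v x powr q) \<partial>M) < \<infinity>"
    and weak: "\<And>t. t > 0 \<Longrightarrow> ennreal t * emeasure M {x\<in>space M. t < v x} \<le> (\<integral>\<^sup>+ x\<in>{x. t < v x}. ennreal (w x) \<partial>M)"
  shows "(\<integral>\<^sup>+ x. ennreal (v x powr q) \<partial>M)
    \<le> ennreal ((2 * q / (q - 1)) powr q) * (\<integral>\<^sup>+ x. ennreal (w x powr q) \<partial>M)"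
proof -
  define c where "c = q / (q - 1)"
  have c: "c > 0" using q by (simp add: c_def)
  let ?V = "\<integral>\<^sup>+ x. ennreal (v x powr q) \<partial>M"
  let ?W = "\<integral>\<^sup>+ x. ennreal (w x powr q) \<partial>M"
  have split: "ennreal (a * b + 1 / 2 * d) = ennreal a * ennreal b + ennreal (1 / 2) * ennreal d"
    if "a \<ge> 0" "b \<ge> 0" "d \<ge> 0" for a b d :: real
    using that ennreal_mult[of a b] ennreal_mult[of "1 / 2" d] ennreal_plus[of "a * b" "1 / 2 * d"]
    by simp
  have pw: "c * (w x * v x powr (q - 1)) \<le> (2 * c) powr q / 2 * w x powr q + 1 / 2 * v x powr q"
    if x: "x \<in> space M" for x
  \<comment> \<open>Either \<open>v\<close> dominates and half of \<open>v\<^sup>q\<close> suffices, or \<open>v\<close> can be replaced by \<open>2 c w\<close>.\<close>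
  proof (cases "2 * c * w x \<le> v x")
    case True
    have "2 * c * w x * v x powr (q - 1) \<le> v x * v x powr (q - 1)"
      using True by (intro mult_right_mono) auto
    also have "\<dots> = v x powr q" using v[OF x] by (cases "v x = 0") (auto simp: powr_mult_base)
    finally have "2 * c * w x * v x powr (q - 1) \<le> v x powr q" .
    moreover have "0 \<le> (2 * c) powr q / 2 * w x powr q" using c by simp
    moreover have "c * (w x * v x powr (q - 1)) = 2 * c * w x * v x powr (q - 1) / 2" by simp
    ultimately show ?thesis by linarith
  next
    case False
    have "2 * c * w x * v x powr (q - 1) \<le> 2 * c * w x * (2 * c * w x) powr (q - 1)"
      using False c w[OF x] v[OF x] q by (intro mult_left_mono powr_mono2) auto
    also have "\<dots> = (2 * c * w x) powr q" using c w[OF x]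
      by (subst powr_mult_base) auto
    also have "\<dots> = (2 * c) powr q * w x powr q" using c w[OF x] by (simp add: powr_mult)
    finally show ?thesis by (simp add: field_simps add_increasing)
  qed
  have "?V = (\<integral>\<^sup>+ t\<in>{0<..}. ennreal (q * t powr (q - 1)) * emeasure M {x\<in>space M. t < v x} \<partial>lborel)"
    using v q by (intro nn_integral_powr_eq_superlevel) auto
  also have "\<dots> \<le> (\<integral>\<^sup>+ t. ennreal c * (ennreal ((q - 1) * t powr ((q - 1) - 1)) * (\<integral>\<^sup>+ x\<in>{x. t < v x}. ennreal (w x) \<partial>M) * indicator {0<..} t) \<partial>lborel)"
  proof (intro nn_integral_mono)
    fix t :: real
    have "ennreal (q * t powr (q - 1)) * emeasure M {x\<in>space M. t < v x}
      \<le> ennreal c * (ennreal ((q - 1) * t powr ((q - 1) - 1)) * (\<integral>\<^sup>+ x\<in>{x. t < v x}. ennreal (w x) \<partial>M))" if t: "t > 0"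
    proof -
      have "t powr (q - 1) = t powr (q - 2) * t" using t powr_mult_base[of t "q - 2"] by (simp add: mult_ac)
      then have "q * t powr (q - 1) = c * ((q - 1) * t powr ((q - 1) - 1)) * t"
        using q by (simp add: c_def)
      then have "ennreal (q * t powr (q - 1)) * emeasure M {x\<in>space M. t < v x}
        = ennreal (c * ((q - 1) * t powr ((q - 1) - 1))) * (ennreal t * emeasure M {x\<in>space M. t < v x})"
        using c q t by (simp add: ennreal_mult mult_ac)
      also have "\<dots> \<le> ennreal (c * ((q - 1) * t powr ((q - 1) - 1))) * (\<integral>\<^sup>+ x\<in>{x. t < v x}. ennreal (w x) \<partial>M)"
        by (intro mult_left_mono weak t) auto
      finally show ?thesis using c q t by (simp add: ennreal_mult mult_ac)
    qed
    then show "ennreal (q * t powr (q - 1)) * emeasure M {x\<in>space M. t < v x} * indicator {0<..} t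
      \<le> ennreal c * (ennreal ((q - 1) * t powr ((q - 1) - 1)) * (\<integral>\<^sup>+ x\<in>{x. t < v x}. ennreal (w x) \<partial>M) * indicator {0<..} t)"
      by (auto split: split_indicator)
  qed
  also have "\<dots> = ennreal c * (\<integral>\<^sup>+ x. ennreal (w x) * ennreal (v x powr (q - 1)) \<partial>M)"
    using v q by (subst nn_integral_layer_cake) (auto simp: nn_integral_cmult)
  also have "\<dots> = (\<integral>\<^sup>+ x. ennreal (c * (w x * v x powr (q - 1))) \<partial>M)"
    using c w by (subst nn_integral_cmult[symmetric]) (auto intro!: nn_integral_cong simp: ennreal_mult)
  also have "\<dots> \<le> (\<integral>\<^sup>+ x. ennreal ((2 * c) powr q / 2 * w x powr q + 1 / 2 * v x powr q) \<partial>M)"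
    using pw by (intro nn_integral_mono ennreal_leI) auto
  also have "\<dots> = (\<integral>\<^sup>+ x. ennreal ((2 * c) powr q / 2) * ennreal (w x powr q) + ennreal (1 / 2) * ennreal (v x powr q) \<partial>M)"
    by (intro nn_integral_cong split) auto
  also have "\<dots> = ennreal ((2 * c) powr q / 2) * ?W + ennreal (1 / 2) * ?V"
    by (simp add: nn_integral_add nn_integral_cmult)
  finally have main: "?V \<le> ennreal ((2 * c) powr q / 2) * ?W + ennreal (1 / 2) * ?V" .
  show ?thesis
  proof (cases "?W = \<infinity>")
    case True then show ?thesis using c by (auto simp: ennreal_mult_top c_def)
  next
    case False
    obtain V where V: "?V = ennreal V" "V \<ge> 0" using fin by (cases ?V) auto
    obtain W where W: "?W = ennreal W" "W \<ge> 0" using False by (cases ?W) auto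
    have "ennreal V \<le> ennreal ((2 * c) powr q / 2 * W + 1 / 2 * V)"
      using main unfolding V W by (subst split) (use V(2) W(2) in auto)
    then have "V \<le> (2 * c) powr q / 2 * W + 1 / 2 * V"
      using V(2) W(2) by (subst (asm) ennreal_le_iff) auto
    then have "V \<le> (2 * c) powr q * W" by simp
    then have "V \<le> (2 * q / (q - 1)) powr q * W" by (simp add: c_def)
    then show ?thesis unfolding V W using V(2) W(2) by (simp flip: ennreal_mult)
  qed
qed

section \<open>The tree of dyadic intervals\<close>

lemma dyadicE:
  assumes "I \<in> dyadic_intervals"
  obtains k j :: nat where "j < 2 ^ k" "I = {real j / 2 ^ k ..< real (j + 1) / 2 ^ k}"
    "measure lebesgue I = 1 / 2 ^ k"
proof -
  from assms obtain k j :: nat where *: "j < 2 ^ k" "I = {real j / 2 ^ k ..< real (j + 1) / 2 ^ k}"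
    unfolding dyadic_intervals_def by blast
  moreover have "measure lebesgue I = 1 / 2 ^ k"
    unfolding * by (simp add: divide_right_mono flip: diff_divide_distrib)
  ultimately show ?thesis using that by blast
qed

text \<open>
  An interval of length \<open>2\<^bsup>-m\<^esup>\<close> is not cut by a multiple of \<open>2\<^bsup>-m\<^esup>\<close>. Both the nestedness of
  dyadic intervals and the constancy of Haar functions on shorter intervals come down to this.
\<close>

lemma dyadic_less_grid_point_iff:
  fixes i m c :: nat
  assumes "x \<in> {real i / 2 ^ m ..< real (i + 1) / 2 ^ m}"
  shows "x < real c / 2 ^ m \<longleftrightarrow> i < c"
proof
  assume "x < real c / 2 ^ m"
  then have "real i / 2 ^ m < real c / 2 ^ m" using assms by auto
  then show "i < c" by (simp add: divide_less_cancel)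
next
  assume "i < c"
  then have "real (i + 1) / 2 ^ m \<le> real c / 2 ^ m" by (intro divide_right_mono) auto
  then show "x < real c / 2 ^ m" using assms by auto
qed

lemma grid_refine:
  fixes j k m :: nat
  assumes "k \<le> m"
  shows "real j / 2 ^ k = real (j * 2 ^ (m - k)) / 2 ^ m"
  using assms by (simp add: field_simps flip: power_add)

text \<open>
  The end points of \<open>I\<close> are multiples of the length of \<open>J\<close>, so they do not separate points of \<open>J\<close>.
\<close>

lemma dyadic_nested:
  assumes I: "I \<in> dyadic_intervals" and J: "J \<in> dyadic_intervals"
    and le: "measure lebesgue J \<le> measure lebesgue I" and meet: "J \<inter> I \<noteq> {}"
  shows "J \<subseteq> I"
proof
  fix y assume y: "y \<in> J"
  obtain x where x: "x \<in> J" "x \<in> I" using meet by blast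
  obtain k j where I': "I = {real j / 2 ^ k ..< real (j + 1) / 2 ^ k}" "measure lebesgue I = 1 / 2 ^ k"
    using I by (rule dyadicE)
  obtain m i where J': "J = {real i / 2 ^ m ..< real (i + 1) / 2 ^ m}" "measure lebesgue J = 1 / 2 ^ m"
    using J by (rule dyadicE)
  have "(2::real) ^ k \<le> 2 ^ m" using le I'(2) J'(2) by (simp add: field_simps)
  then have km: "k \<le> m" by simp
  have "x < c \<longleftrightarrow> y < c" if "c = real n / 2 ^ k" for n c
    unfolding that grid_refine[OF km]
    using dyadic_less_grid_point_iff x(1) y unfolding J' by metis
  then show "y \<in> I" using x(2) unfolding I' by (metis atLeastLessThan_iff not_le)
qed

text \<open>
  Lengths are powers of two. Consequently, discarding the intervals that are at most as long as a half
  of \<open>I\<close> keeps exactly those that are at least as long as \<open>I\<close>.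
\<close>

lemma dyadic_measure_double:
  assumes "I \<in> dyadic_intervals" "J \<in> dyadic_intervals"
    and lt: "measure lebesgue J < measure lebesgue I"
  shows "2 * measure lebesgue J \<le> measure lebesgue I"
proof -
  obtain k where k: "measure lebesgue I = 1 / 2 ^ k" using assms(1) by (rule dyadicE)
  obtain m where m: "measure lebesgue J = 1 / 2 ^ m" using assms(2) by (rule dyadicE)
  have "(2::real) ^ k < 2 ^ m" using lt k m by (simp add: field_simps)
  then have "Suc k \<le> m" by simp
  then have "(2::real) ^ Suc k \<le> 2 ^ m" by (intro power_increasing) auto
  then show ?thesis unfolding k m by (simp add: field_simps)
qed

text \<open>
  The midpoint of \<open>I\<close>, too, is a multiple of the length of the strictly shorter interval \<open>J\<close>.
\<close>

lemma haar_constant_on_smaller: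
  assumes I: "I \<in> dyadic_intervals" and J: "J \<in> dyadic_intervals"
    and lt: "measure lebesgue J < measure lebesgue I" and "x \<in> J" "y \<in> J"
  shows "haar I x = haar I y"
proof -
  obtain k j where I': "I = {real j / 2 ^ k ..< real (j + 1) / 2 ^ k}" "measure lebesgue I = 1 / 2 ^ k"
    using I by (rule dyadicE)
  obtain m i where J': "J = {real i / 2 ^ m ..< real (i + 1) / 2 ^ m}" "measure lebesgue J = 1 / 2 ^ m"
    using J by (rule dyadicE)
  have "(2::real) ^ k < 2 ^ m" using lt I'(2) J'(2) by (simp add: field_simps)
  then have km: "Suc k \<le> m" by simp
  have *: "x < c \<longleftrightarrow> y < c" if "c = real n / 2 ^ Suc k" for n c
    unfolding that grid_refine[OF km]
    using dyadic_less_grid_point_iff assms(4,5) unfolding J' by metis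
  have lt: "real j / 2 ^ k < real (j + 1) / 2 ^ k" by (intro divide_strict_right_mono) auto
  have "(Inf I + Sup I) / 2 = real (2 * j + 1) / 2 ^ Suc k"
    unfolding I' using lt by (simp add: field_simps)
  moreover have "real j / 2 ^ k = real (2 * j) / 2 ^ Suc k"
    "real (j + 1) / 2 ^ k = real (2 * (j + 1)) / 2 ^ Suc k" by (simp_all add: field_simps)
  ultimately have "x < (Inf I + Sup I) / 2 \<longleftrightarrow> y < (Inf I + Sup I) / 2"
    "x < real j / 2 ^ k \<longleftrightarrow> y < real j / 2 ^ k"
    "x < real (j + 1) / 2 ^ k \<longleftrightarrow> y < real (j + 1) / 2 ^ k"
    by (metis *)+
  moreover from this(2,3) have "x \<in> I \<longleftrightarrow> y \<in> I"
    unfolding I'(1) by (simp only: atLeastLessThan_iff flip: not_less)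
  ultimately show ?thesis unfolding haar_def by simp
qed

lemma dyadic_halves:
  assumes I: "I \<in> dyadic_intervals"
  obtains L R where "L \<in> dyadic_intervals" "R \<in> dyadic_intervals" "I = L \<union> R"
    "2 * measure lebesgue L = measure lebesgue I" "2 * measure lebesgue R = measure lebesgue I"
proof -
  obtain k j where I': "j < 2 ^ k" "I = {real j / 2 ^ k ..< real (j + 1) / 2 ^ k}" "measure lebesgue I = 1 / 2 ^ k"
    using I by (rule dyadicE)
  define H where "H i = {real i / 2 ^ Suc k ..< real (i + 1) / 2 ^ Suc k}" for i
  have "H i \<in> dyadic_intervals" if "i < 2 ^ Suc k" for i
    using that unfolding dyadic_intervals_def H_def by blast
  then have "H (2 * j) \<in> dyadic_intervals" "H (2 * j + 1) \<in> dyadic_intervals"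
    using I'(1) by auto
  moreover have "measure lebesgue (H i) = 1 / 2 ^ Suc k" for i
    unfolding H_def by (simp add: divide_right_mono flip: diff_divide_distrib)
  then have "2 * measure lebesgue (H i) = measure lebesgue I" for i
    unfolding I'(3) by simp
  moreover have "I = H (2 * j) \<union> H (2 * j + 1)"
  proof -
    have "real j / 2 ^ k = real (2 * j) / 2 ^ Suc k" "real (j + 1) / 2 ^ k = real (2 * j + 1 + 1) / 2 ^ Suc k"
      by (simp_all add: field_simps)
    moreover have "real (2 * j) / 2 ^ Suc k \<le> real (2 * j + 1) / 2 ^ Suc k"
      "real (2 * j + 1) / 2 ^ Suc k \<le> real (2 * j + 1 + 1) / 2 ^ Suc k"
      by (intro divide_right_mono; simp)+
    ultimately show ?thesis
      unfolding I'(2) H_def by (simp only: ivl_disj_un_two(3))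
  qed
  ultimately show ?thesis using that by blast
qed

lemma dyadic_interval_properties:
  assumes "I \<in> dyadic_intervals"
  shows dyadic_subset_unit: "I \<subseteq> {0..<1}" and dyadic_lmeasurable: "I \<in> lmeasurable"
    and dyadic_measure_pos: "measure lebesgue I > 0" and dyadic_borel: "I \<in> sets borel"
proof -
  obtain k j where I': "j < 2 ^ k" "I = {real j / 2 ^ k ..< real (j + 1) / 2 ^ k}" "measure lebesgue I = 1 / 2 ^ k"
    using assms by (rule dyadicE)
  have "real (j + 1) \<le> 2 ^ k" using I'(1) by (metis Suc_eq_plus1 Suc_leI of_nat_le_iff of_nat_numeral of_nat_power)
  then have "real (j + 1) / 2 ^ k \<le> 1" by simp
  moreover have "0 \<le> real j / 2 ^ k" by simp
  ultimately show "I \<subseteq> {0..<1}" unfolding I' by (intro subsetI) (unfold atLeastLessThan_iff, linarith)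
  show "I \<in> lmeasurable" unfolding I' by (rule bounded_set_imp_lmeasurable) auto
qed (use assms in \<open>auto elim!: dyadicE\<close>)

text \<open>
  The members that are maximal for inclusion: two dyadic intervals that meet are nested.
\<close>

lemma maximal_dyadic_subfamily:
  assumes B: "finite B" "B \<subseteq> dyadic_intervals"
  obtains B' where "B' \<subseteq> B" "disjoint B'" "\<Union>B' = \<Union>B"
proof
  define B' where "B' = {I \<in> B. \<forall>J\<in>B. I \<subseteq> J \<longrightarrow> J = I}"
  show "B' \<subseteq> B" by (auto simp: B'_def)
  show "disjoint B'"
  proof (rule disjointI)
    fix I J assume IJ: "I \<in> B'" "J \<in> B'" "I \<noteq> J"
    then have "I \<in> dyadic_intervals" "J \<in> dyadic_intervals" using B by (auto simp: B'_def)
    then show "I \<inter> J = {}"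
      using dyadic_nested[of I J] dyadic_nested[of J I] IJ linear[of "measure lebesgue I" "measure lebesgue J"]
      by (auto simp: B'_def)
  qed
  have "\<Union>B \<subseteq> \<Union>B'"
  proof
    fix x assume "x \<in> \<Union>B"
    then obtain I where I: "x \<in> I" "I \<in> B" by blast
    then obtain J where "J \<in> B" "I \<subseteq> J" "\<forall>K\<in>B. J \<subseteq> K \<longrightarrow> J = K"
      using finite_has_maximal2[OF B(1), of I] by blast
    then show "x \<in> \<Union>B'" using I unfolding B'_def by blast
  qed
  then show "\<Union>B' = \<Union>B" by (auto simp: B'_def)
qed

section \<open>Integrals of Haar functions\<close>

lemma haar_outside: "x \<notin> I \<Longrightarrow> haar I x = 0"
  by (simp add: haar_def)

lemma haar_inside: "x \<in> I \<Longrightarrow> \<bar>haar I x\<bar> = 1"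
  by (simp add: haar_def)

lemma haar_has_integral_0:
  assumes I: "I \<in> dyadic_intervals" and J: "J \<in> dyadic_intervals"
    and le: "measure lebesgue I \<le> measure lebesgue J"
  shows "(haar I has_integral 0) J"
proof (cases "I \<inter> J = {}")
  case True
  then show ?thesis by (intro has_integral_is_0) (auto simp: haar_def)
next
  case False
  then have sub: "I \<subseteq> J" using dyadic_nested[OF J I le] by simp
  obtain a b where ab: "a < b" and h: "haar I = (\<lambda>x. indicat_real {a..<(a + b) / 2} x - indicat_real {(a + b) / 2..<b} x)"
    using I by (rule haar_dyadic)
  have ind: "(indicat_real {c..<d} has_integral (d - c)) UNIV" if "c \<le> d" for c d :: real
  proof -
    have "{c..<d} \<in> lmeasurable" by (rule bounded_set_imp_lmeasurable) auto
    with that show ?thesis by (simp add: lmeasurable_iff_has_integral)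
  qed
  have "(haar I has_integral (((a + b) / 2 - a) - (b - (a + b) / 2))) UNIV"
    unfolding h using ab by (intro has_integral_diff ind) auto
  then have "(haar I has_integral 0) UNIV" by (simp add: field_simps)
  moreover have "haar I = (\<lambda>x. if x \<in> J then haar I x else 0)"
    using sub by (auto simp: haar_def fun_eq_iff)
  ultimately show ?thesis using has_integral_restrict_UNIV[of J "haar I"] by metis
qed

lemma has_integral_const_lmeasurable:
  fixes c :: real
  assumes "J \<in> lmeasurable"
  shows "((\<lambda>_. c) has_integral (measure lebesgue J * c)) J"
proof -
  have "((\<lambda>x. 1::real) has_integral measure lebesgue J) J"
    using assms lmeasure_integral lmeasurable_iff_integrable_on by (metis integrable_integral)
  from has_integral_mult_left[OF this, of c] show ?thesis by simp
qed

lemma haar_has_integral_on_smaller: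
  assumes I: "I \<in> dyadic_intervals" and J: "J \<in> dyadic_intervals"
    and lt: "measure lebesgue J < measure lebesgue I" and x: "x \<in> J"
  shows "(haar I has_integral (measure lebesgue J * haar I x)) J"
  by (rule has_integral_eq[OF _ has_integral_const_lmeasurable])
    (use haar_constant_on_smaller[OF I J lt x] dyadic_interval_properties[OF J] in auto)

lemma simple_function_haar_combination:
  fixes a :: "'b \<Rightarrow> 'a::real_vector"
  assumes "\<And>I. I \<in> B \<Longrightarrow> \<sigma> I \<in> dyadic_intervals"
  shows "simple_function borel (\<lambda>x. \<Sum>I\<in>B. haar (\<sigma> I) x *\<^sub>R a I)"
proof (intro simple_function_sum simple_function_compose1[where g="\<lambda>c. c *\<^sub>R a _"])
  fix I assume "I \<in> B"
  then obtain b c where h: "haar (\<sigma> I) = (\<lambda>x. indicat_real {b..<(b + c) / 2} x - indicat_real {(b + c) / 2..<c} x)"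
    using assms haar_dyadic by metis
  show "simple_function borel (haar (\<sigma> I))"
  proof (rule simple_function_borel_measurable)
    show "haar (\<sigma> I) \<in> borel_measurable borel" unfolding h by simp
    show "finite (haar (\<sigma> I) ` space borel)"
      by (rule finite_subset[of _ "{0, 1, - 1}"]) (auto simp: haar_def)
  qed
qed

lemma borel_measurable_norm_haar_combination:
  fixes a :: "'b \<Rightarrow> 'a::real_normed_vector"
  assumes "\<And>I. I \<in> B \<Longrightarrow> \<sigma> I \<in> dyadic_intervals"
  shows "(\<lambda>x. norm (\<Sum>I\<in>B. haar (\<sigma> I) x *\<^sub>R a I)) \<in> borel_measurable borel"
  using simple_function_haar_combination[OF assms]
  by (intro borel_measurable_simple_function simple_function_compose1[where g=norm])

lemma norm_haar_combination_le: "norm (\<Sum>I\<in>B. haar (\<sigma> I) x *\<^sub>R a I) \<le> (\<Sum>I\<in>B. norm (a I))"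
  by (rule sum_norm_le) (auto simp: haar_def)

lemma integrable_on_norm_haar_combination:
  fixes a :: "'b \<Rightarrow> 'a::real_normed_vector"
  assumes "\<And>I. I \<in> B \<Longrightarrow> \<sigma> I \<in> dyadic_intervals" and S: "S \<in> lmeasurable"
  shows "(\<lambda>x. norm (\<Sum>I\<in>B. haar (\<sigma> I) x *\<^sub>R a I)) integrable_on S"
proof (rule measurable_bounded_by_integrable_imp_integrable)
  show "(\<lambda>x. norm (\<Sum>I\<in>B. haar (\<sigma> I) x *\<^sub>R a I)) \<in> borel_measurable (lebesgue_on S)"
    using borel_measurable_norm_haar_combination[OF assms(1), of B]
    by (intro measurable_restrict_space1 measurable_completion) auto
  show "(\<lambda>_. \<Sum>I\<in>B. norm (a I)) integrable_on S"
    using S by (rule integrable_on_const)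
  show "S \<in> sets lebesgue" using S by auto
qed (use norm_haar_combination_le in auto)

abbreviation unit_lebesgue :: "real measure"
  where "unit_lebesgue \<equiv> lebesgue_on {0..<1}"

lemma finite_measure_unit_lebesgue: "finite_measure unit_lebesgue"
  by (intro finite_measure_lebesgue_on bounded_set_imp_lmeasurable) auto

lemma sets_unit_lebesgueI: "S \<in> sets borel \<Longrightarrow> S \<subseteq> {0..<1} \<Longrightarrow> S \<in> sets unit_lebesgue"
  by (auto simp: sets_restrict_space intro!: image_eqI[of _ _ S])

lemma measurable_unit_lebesgueI:
  "f \<in> borel_measurable borel \<Longrightarrow> f \<in> borel_measurable unit_lebesgue"
  by (intro measurable_restrict_space1 measurable_completion) auto

lemma emeasure_unit_lebesgue:
  "S \<subseteq> {0..<1} \<Longrightarrow> emeasure unit_lebesgue S = emeasure lebesgue S"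
  by (intro emeasure_restrict_space) auto

lemma emeasure_dyadic:
  "I \<in> dyadic_intervals \<Longrightarrow> emeasure unit_lebesgue I = ennreal (measure lebesgue I)"
  using dyadic_interval_properties[of I] by (simp add: emeasure_unit_lebesgue emeasure_eq_measure2)

lemma Union_dyadic:
  assumes "finite B" "B \<subseteq> dyadic_intervals"
  shows "\<Union>B \<subseteq> {0..<1}" "\<Union>B \<in> sets borel" "\<Union>B \<in> sets unit_lebesgue"
proof -
  show 1: "\<Union>B \<subseteq> {0..<1}" "\<Union>B \<in> sets borel"
    using assms dyadic_interval_properties by (blast, intro sets.finite_Union, auto)
  show "\<Union>B \<in> sets unit_lebesgue" using 1 by (intro sets_unit_lebesgueI)
qed

lemma set_nn_integral_unit_lebesgue:
  assumes K: "K \<subseteq> {0..<1}" and w: "\<And>x. 0 \<le> w x" and int: "(w has_integral i) K"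
  shows "(\<integral>\<^sup>+ x\<in>K. ennreal (w x) \<partial>unit_lebesgue) = ennreal i"
proof -
  have "(\<integral>\<^sup>+ x\<in>K. ennreal (w x) \<partial>unit_lebesgue)
      = (\<integral>\<^sup>+ x. ennreal (w x) * indicator K x * indicator {0..<1} x \<partial>lebesgue)"
    by (intro nn_integral_restrict_space) auto
  also have "\<dots> = (\<integral>\<^sup>+ x. ennreal (indicator K x * w x) \<partial>lebesgue)"
    using K by (intro nn_integral_cong) (auto split: split_indicator)
  also have "\<dots> = ennreal i"
    using nn_integral_has_integral_lebesgue[OF w int] by (simp add: nn_integral_completion)
  finally show ?thesis .
qed

lemma unit_interval_dyadic: "{0..<1} \<in> dyadic_intervals"
  unfolding dyadic_intervals_def by (intro CollectI exI[of _ 0]) auto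

text \<open>
  Where the shorter of the two intervals lives, the Haar function of the longer one is constant, and
  the other one has mean zero. Distinct intervals of equal length are disjoint.
\<close>

lemma haar_mult_haar_has_integral:
  assumes I: "I \<in> dyadic_intervals" and J: "J \<in> dyadic_intervals"
  shows "((\<lambda>x. haar I x * haar J x) has_integral (if I = J then measure lebesgue I else 0)) {0..<1}"
proof -
  have le1: "measure lebesgue K \<le> measure lebesgue {0..<1::real}" if "K \<in> dyadic_intervals" for K
    using dyadic_interval_properties[OF that] by (intro measure_mono_fmeasurable) (auto intro: bounded_set_imp_lmeasurable)
  have h0: "((\<lambda>x. haar I x * haar J x) has_integral 0) {0..<1}"
    if I: "I \<in> dyadic_intervals" and J: "J \<in> dyadic_intervals" and lt: "measure lebesgue J < measure lebesgue I" for I J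
  proof -
    obtain y where y: "y \<in> J" using dyadic_measure_pos[OF J] by (metis measure_empty less_irrefl equals0I)
    have "haar I x * haar J x = haar I y * haar J x" for x
      using haar_constant_on_smaller[OF I J lt _ y] by (cases "x \<in> J") (auto simp: haar_outside)
    then have "(\<lambda>x. haar I x * haar J x) = (\<lambda>x. haar I y * haar J x)" ..
    then show ?thesis
      using has_integral_mult_right[OF haar_has_integral_0[OF J unit_interval_dyadic le1[OF J]], of "haar I y"] by simp
  qed
  consider "measure lebesgue J < measure lebesgue I" | "measure lebesgue I < measure lebesgue J"
    | "I = J" | "measure lebesgue J = measure lebesgue I" "I \<noteq> J" by linarith
  then show ?thesis
  proof cases
    case 1 then show ?thesis using h0[OF I J] by auto
  next
    case 2 then show ?thesis using h0[OF J I] by (auto simp: mult.commute)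
  next
    case 3
    have "(indicat_real I has_integral measure lebesgue I) UNIV"
      using dyadic_lmeasurable[OF I] by (simp add: lmeasurable_iff_has_integral)
    moreover have "indicat_real I = (\<lambda>x. if x \<in> {0..<1} then haar I x * haar J x else 0)"
      using 3 dyadic_subset_unit[OF I] by (auto simp: fun_eq_iff haar_def split: split_indicator)
    ultimately have "((\<lambda>x. if x \<in> {0..<1} then haar I x * haar J x else 0) has_integral measure lebesgue I) UNIV"
      by (simp only:)
    then show ?thesis using 3 by (simp only: has_integral_restrict_UNIV if_True refl)
  next
    case 4
    then have "I \<inter> J = {}" using dyadic_nested[OF I J] dyadic_nested[OF J I] by (auto simp: Int_commute)
    then have "haar I x * haar J x = 0" for x by (cases "x \<in> I") (auto simp: haar_outside disjoint_iff)
    with 4 show ?thesis by (auto intro: has_integral_is_0)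
  qed
qed

lemma nn_integral_haar_sum_square:
  assumes B: "finite B" "B \<subseteq> dyadic_intervals"
  shows "(\<integral>\<^sup>+ x. ennreal ((\<Sum>I\<in>B. haar I x)\<^sup>2) \<partial>unit_lebesgue) = (\<Sum>I\<in>B. emeasure unit_lebesgue I)"
proof -
  have "((\<lambda>x. (\<Sum>I\<in>B. haar I x)\<^sup>2) has_integral (\<Sum>I\<in>B. \<Sum>J\<in>B. if I = J then measure lebesgue I else 0)) {0..<1}"
    unfolding power2_eq_square sum_product
    using B by (intro has_integral_sum haar_mult_haar_has_integral) auto
  then have "((\<lambda>x. (\<Sum>I\<in>B. haar I x)\<^sup>2) has_integral (\<Sum>I\<in>B. measure lebesgue I)) {0..<1}"
    using B by simp
  from set_nn_integral_unit_lebesgue[OF _ _ this]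
  have "(\<integral>\<^sup>+ x\<in>{0..<1}. ennreal ((\<Sum>I\<in>B. haar I x)\<^sup>2) \<partial>unit_lebesgue) = ennreal (\<Sum>I\<in>B. measure lebesgue I)"
    by simp
  moreover have "(\<integral>\<^sup>+ x\<in>{0..<1}. ennreal ((\<Sum>I\<in>B. haar I x)\<^sup>2) \<partial>unit_lebesgue)
      = (\<integral>\<^sup>+ x. ennreal ((\<Sum>I\<in>B. haar I x)\<^sup>2) \<partial>unit_lebesgue)"
    by (intro nn_integral_cong) auto
  ultimately have "(\<integral>\<^sup>+ x. ennreal ((\<Sum>I\<in>B. haar I x)\<^sup>2) \<partial>unit_lebesgue) = ennreal (\<Sum>I\<in>B. measure lebesgue I)"
    by simp
  moreover have "(\<Sum>I\<in>B. emeasure unit_lebesgue I) = (\<Sum>I\<in>B. ennreal (measure lebesgue I))"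
    using B by (intro sum.cong emeasure_dyadic) auto
  ultimately show ?thesis by simp
qed

section \<open>The dyadic maximal function\<close>

text \<open>
  Jensen's inequality for the Haar martingale. On \<open>C\<close> the Haar functions of longer intervals are
  constant and all others have mean zero, so the truncated sum at a point of \<open>C\<close> is the average of
  the full sum over \<open>C\<close>. The average is a Henstock-Kurzweil integral, which makes sense in a Banach
  space that is not separable.
\<close>

lemma norm_truncated_haar_sum_le_integral:
  fixes a :: "real set \<Rightarrow> 'a::banach"
  assumes F: "finite F" "F \<subseteq> dyadic_intervals" and C: "C \<in> dyadic_intervals" and x: "x \<in> C"
  shows "measure lebesgue C * norm (\<Sum>I | I \<in> F \<and> measure lebesgue C < measure lebesgue I. haar I x *\<^sub>R a I)
    \<le> integral C (\<lambda>y. norm (\<Sum>I\<in>F. haar I y *\<^sub>R a I))"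
proof -
  \<comment> \<open>The integral of \<open>h\<^sub>I\<close> over \<open>C\<close>.\<close>
  define c where "c I = (if measure lebesgue C < measure lebesgue I then measure lebesgue C * haar I x else 0)" for I
  have hI: "(haar I has_integral c I) C" if "I \<in> F" for I
    using that F C x haar_has_integral_0[of I C] haar_has_integral_on_smaller[of I C x]
    by (auto simp: c_def not_less)
  have int: "((\<lambda>y. \<Sum>I\<in>F. haar I y *\<^sub>R a I) has_integral (\<Sum>I\<in>F. c I *\<^sub>R a I)) C"
    using F(1) by (intro has_integral_sum has_integral_scaleR_left hI)
  have "(\<Sum>I\<in>F. c I *\<^sub>R a I)
      = measure lebesgue C *\<^sub>R (\<Sum>I | I \<in> F \<and> measure lebesgue C < measure lebesgue I. haar I x *\<^sub>R a I)"
    unfolding scaleR_sum_right using F(1) by (intro sum.mono_neutral_cong_right) (auto simp: c_def)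
  then have "measure lebesgue C * norm (\<Sum>I | I \<in> F \<and> measure lebesgue C < measure lebesgue I. haar I x *\<^sub>R a I)
     = norm (integral C (\<lambda>y. \<Sum>I\<in>F. haar I y *\<^sub>R a I))"
    using integral_unique[OF int] by simp
  also have "\<dots> \<le> integral C (\<lambda>y. norm (\<Sum>I\<in>F. haar I y *\<^sub>R a I))"
  proof (rule integral_norm_bound_integral)
    show "(\<lambda>y. \<Sum>I\<in>F. haar I y *\<^sub>R a I) integrable_on C" using int by blast
    show "(\<lambda>y. norm (\<Sum>I\<in>F. haar I y *\<^sub>R a I)) integrable_on C"
      using F dyadic_interval_properties[OF C] by (intro integrable_on_norm_haar_combination[where \<sigma>="\<lambda>I. I"]) auto
  qed simp
  finally show ?thesis .
qed

text \<open>
  For disjoint intervals the inequalities between the averages add up, and the maximal members of a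
  dyadic family are disjoint.
\<close>

lemma emeasure_Union_le_of_averages:
  fixes t :: real
  assumes B: "finite B" "B \<subseteq> dyadic_intervals" and w: "\<And>x. 0 \<le> w x"
    and wm: "w \<in> borel_measurable unit_lebesgue" and t: "0 \<le> t"
    and avg: "\<And>K. K \<in> B \<Longrightarrow> w integrable_on K \<and> t * measure lebesgue K \<le> integral K w"
  shows "ennreal t * emeasure unit_lebesgue (\<Union>B) \<le> (\<integral>\<^sup>+ x\<in>\<Union>B. ennreal (w x) \<partial>unit_lebesgue)"
proof -
  obtain B' where B': "B' \<subseteq> B" "disjoint B'" "\<Union>B' = \<Union>B"
    using maximal_dyadic_subfamily[OF B] .
  have fin: "finite B'" using B' B finite_subset by blast
  have disj: "disjoint_family_on (\<lambda>K. K) B'" using B'(2) by (auto simp: disjoint_family_on_def disjoint_def)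
  have sets: "(\<lambda>K. K) ` B' \<subseteq> sets unit_lebesgue"
  proof
    fix K assume "K \<in> (\<lambda>K. K) ` B'"
    then have "K \<in> dyadic_intervals" using B' B by auto
    then show "K \<in> sets unit_lebesgue" using dyadic_interval_properties by (intro sets_unit_lebesgueI)
  qed
  \<comment> \<open>As a measure, the integral of \<open>w\<close> is additive over disjoint sets.\<close>
  define N where "N = density unit_lebesgue (\<lambda>x. ennreal (w x))"
  have N: "emeasure N A = (\<integral>\<^sup>+ x\<in>A. ennreal (w x) \<partial>unit_lebesgue)" if "A \<in> sets unit_lebesgue" for A
    unfolding N_def using wm that by (intro emeasure_density) auto
  have le: "ennreal t * emeasure unit_lebesgue K \<le> emeasure N K" if "K \<in> B'" for K
  proof -
    have K: "K \<in> dyadic_intervals" "w integrable_on K" "t * measure lebesgue K \<le> integral K w"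
      using that B' B avg by auto
    have "ennreal t * emeasure unit_lebesgue K = ennreal (t * measure lebesgue K)"
      using K t by (simp add: emeasure_dyadic ennreal_mult)
    also have "\<dots> \<le> ennreal (integral K w)" using K by (intro ennreal_leI)
    also have "\<dots> = emeasure N K"
      using K that sets w dyadic_interval_properties[of K]
      by (subst N) (auto intro!: set_nn_integral_unit_lebesgue[symmetric] integrable_integral)
    finally show ?thesis .
  qed
  have "ennreal t * emeasure unit_lebesgue (\<Union>B') = (\<Sum>K\<in>B'. ennreal t * emeasure unit_lebesgue K)"
    using sum_emeasure[OF sets disj fin] by (simp flip: sum_distrib_left)
  also have "\<dots> \<le> (\<Sum>K\<in>B'. emeasure N K)" by (intro sum_mono le)
  also have "\<dots> = emeasure N (\<Union>B')"
    using sum_emeasure[of "\<lambda>K. K" B' N] sets disj fin by (simp add: N_def)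
  also have "\<dots> = (\<integral>\<^sup>+ x\<in>\<Union>B. ennreal (w x) \<partial>unit_lebesgue)"
    unfolding B'(3) using Union_dyadic[OF B] by (intro N)
  finally show ?thesis unfolding B'(3) .
qed

text \<open>
  A finite Haar sum is governed by its averages over a finite family \<open>G\<close> of intervals, and with \<open>G\<close>
  finite the maximal function takes finitely many values. The inserted \<open>0\<close> is the value at points
  that lie in no member of \<open>G\<close>.
\<close>

definition dyadic_maximal :: "real set set \<Rightarrow> (real \<Rightarrow> real) \<Rightarrow> real \<Rightarrow> real"
  where "dyadic_maximal G w x =
    Max (insert 0 ((\<lambda>K. integral K w / measure lebesgue K) ` {K \<in> G. x \<in> K}))"

lemma less_dyadic_maximal_iff:
  assumes G: "finite G" "G \<subseteq> dyadic_intervals" and t: "0 \<le> t"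
  shows "t < dyadic_maximal G w x \<longleftrightarrow> (\<exists>K\<in>G. x \<in> K \<and> t * measure lebesgue K < integral K w)"
proof -
  have "t < integral K w / measure lebesgue K \<longleftrightarrow> t * measure lebesgue K < integral K w" if "K \<in> G" for K
    using G that dyadic_interval_properties[of K] by (intro pos_less_divide_eq) auto
  then show ?thesis
    unfolding dyadic_maximal_def using G t by (subst Max_gr_iff) auto
qed

lemma average_le_dyadic_maximal:
  assumes "finite G" "K \<in> G" "x \<in> K"
  shows "integral K w / measure lebesgue K \<le> dyadic_maximal G w x"
  unfolding dyadic_maximal_def using assms by (intro Max_ge) auto

lemma dyadic_maximal_nonneg: "finite G \<Longrightarrow> 0 \<le> dyadic_maximal G w x"
  unfolding dyadic_maximal_def by (intro Max_ge) auto

lemma superlevel_dyadic_maximal: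
  assumes G: "finite G" "G \<subseteq> dyadic_intervals" and t: "0 \<le> t"
  shows "{x \<in> {0..<1}. t < dyadic_maximal G w x} = \<Union>{K \<in> G. t * measure lebesgue K < integral K w}"
proof -
  have "K \<subseteq> {0..<1}" if "K \<in> G" for K using that G dyadic_subset_unit by blast
  then show ?thesis by (auto simp only: less_dyadic_maximal_iff[OF G t] mem_Collect_eq set_eq_iff Union_iff)
qed

lemma borel_measurable_dyadic_maximal:
  assumes G: "finite G" "G \<subseteq> dyadic_intervals"
  shows "dyadic_maximal G w \<in> borel_measurable unit_lebesgue"
proof (subst borel_measurable_iff_greater, intro allI)
  fix t :: real
  show "{x \<in> space unit_lebesgue. t < dyadic_maximal G w x} \<in> sets unit_lebesgue"
  proof (cases "0 \<le> t")
    case True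
    have "\<Union>{K \<in> G. t * measure lebesgue K < integral K w} \<in> sets unit_lebesgue"
      using G by (intro Union_dyadic(3)) auto
    then show ?thesis using superlevel_dyadic_maximal[OF G True, of w] by simp
  next
    case False
    then have "{x \<in> space unit_lebesgue. t < dyadic_maximal G w x} = space unit_lebesgue"
      using dyadic_maximal_nonneg[OF G(1), of w] by (auto simp: not_le intro: less_le_trans[of t 0])
    then show ?thesis by (metis sets.top)
  qed
qed

text \<open>
  The level set at height \<open>t\<close> is the union of the intervals of \<open>G\<close> with average greater than \<open>t\<close>, so
  \<open>emeasure_Union_le_of_averages\<close> is the weak-type inequality that Doob's argument starts from.
\<close>

lemma dyadic_maximal_powr_integral_le:
  fixes q :: real
  assumes G: "finite G" "G \<subseteq> dyadic_intervals" and q: "1 < q"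
    and w: "\<And>x. 0 \<le> w x" and wm: "w \<in> borel_measurable unit_lebesgue"
    and int: "\<And>K. K \<in> G \<Longrightarrow> w integrable_on K"
  shows "(\<integral>\<^sup>+ x. ennreal (dyadic_maximal G w x powr q) \<partial>unit_lebesgue)
    \<le> ennreal ((2 * q / (q - 1)) powr q) * (\<integral>\<^sup>+ x. ennreal (w x powr q) \<partial>unit_lebesgue)"
proof -
  interpret finite_measure unit_lebesgue by (rule finite_measure_unit_lebesgue)
  show ?thesis
  proof (rule nn_integral_powr_le_of_weak_type)
    \<comment> \<open>A bound that does not depend on \<open>x\<close>: the maximum over all of \<open>G\<close>.\<close>
    define m where "m = Max (insert 0 ((\<lambda>K. integral K w / measure lebesgue K) ` G))"
    have "dyadic_maximal G w x \<le> m" for x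
      unfolding dyadic_maximal_def m_def using G by (intro Max_mono) auto
    then have "(\<integral>\<^sup>+ x. ennreal (dyadic_maximal G w x powr q) \<partial>unit_lebesgue) \<le> (\<integral>\<^sup>+ x. ennreal (m powr q) \<partial>unit_lebesgue)"
      using dyadic_maximal_nonneg[OF G(1)] q by (intro nn_integral_mono ennreal_leI powr_mono2) auto
    also have "\<dots> < \<infinity>"
      by (simp add: emeasure_unit_lebesgue ennreal_mult_less_top)
    finally show "(\<integral>\<^sup>+ x. ennreal (dyadic_maximal G w x powr q) \<partial>unit_lebesgue) < \<infinity>" .
  next
    fix t :: real assume t: "0 < t"
    define B where "B = {K \<in> G. t * measure lebesgue K < integral K w}"
    have B: "finite B" "B \<subseteq> dyadic_intervals" using G by (auto simp: B_def)
    have eq: "{x \<in> space unit_lebesgue. t < dyadic_maximal G w x} = \<Union>B"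
      unfolding B_def using superlevel_dyadic_maximal[OF G, of t w] t by simp
    have "ennreal t * emeasure unit_lebesgue (\<Union>B) \<le> (\<integral>\<^sup>+ x\<in>\<Union>B. ennreal (w x) \<partial>unit_lebesgue)"
      using t int by (intro emeasure_Union_le_of_averages[OF B w wm]) (auto simp: B_def)
    also have "\<dots> = (\<integral>\<^sup>+ x\<in>{x. t < dyadic_maximal G w x}. ennreal (w x) \<partial>unit_lebesgue)"
      unfolding eq[symmetric] by (intro nn_integral_cong) (auto split: split_indicator)
    finally show "ennreal t * emeasure unit_lebesgue {x \<in> space unit_lebesgue. t < dyadic_maximal G w x}
        \<le> (\<integral>\<^sup>+ x\<in>{x. t < dyadic_maximal G w x}. ennreal (w x) \<partial>unit_lebesgue)"
      unfolding eq .
  qed (use borel_measurable_dyadic_maximal[OF G] dyadic_maximal_nonneg[OF G(1)] w wm q in auto)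
qed

section \<open>Boundedness as an integral inequality\<close>

lemma rearranged_haar_sum_eq_sum:
  assumes "finite F" "F \<subseteq> dyadic_intervals" and "{I \<in> dyadic_intervals. a I \<noteq> 0} \<subseteq> F"
  shows "rearranged_haar_sum \<tau> a x = (\<Sum>I\<in>F. haar (\<tau> I) x *\<^sub>R a I)"
  unfolding rearranged_haar_sum_def using assms by (intro sum.mono_neutral_left) auto

lemma haar_sum_eq_rearranged: "haar_sum a = rearranged_haar_sum (\<lambda>I. I) a"
  by (simp add: haar_sum_def rearranged_haar_sum_def fun_eq_iff)

lemma haar_sum_eq_sum:
  assumes "finite F" "F \<subseteq> dyadic_intervals" and "{I \<in> dyadic_intervals. a I \<noteq> 0} \<subseteq> F"
  shows "haar_sum a x = (\<Sum>I\<in>F. haar I x *\<^sub>R a I)"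
  unfolding haar_sum_eq_rearranged using assms by (rule rearranged_haar_sum_eq_sum)

lemma rearranged_haar_sum_scaleR:
  fixes c :: real
  assumes "c \<noteq> 0"
  shows "rearranged_haar_sum \<tau> (\<lambda>I. c *\<^sub>R a I) x = c *\<^sub>R rearranged_haar_sum \<tau> a x"
  using assms by (simp add: rearranged_haar_sum_def scaleR_sum_right mult.commute)

lemma Lp_norm_nonneg: "0 \<le> Lp_norm p f"
  by (simp add: Lp_norm_def)

lemma Lp_norm_scaleR:
  assumes c: "c > 0" and p: "p > 0"
  shows "Lp_norm p (\<lambda>x. c *\<^sub>R f x) = c * Lp_norm p f"
proof -
  have "integral\<^sup>L unit_lebesgue (\<lambda>x. norm (c *\<^sub>R f x) powr p) = c powr p * integral\<^sup>L unit_lebesgue (\<lambda>x. norm (f x) powr p)"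
    using c by (simp add: powr_mult)
  then show ?thesis
    unfolding Lp_norm_def using c p by (simp add: powr_mult powr_powr)
qed

lemma Lp_norm_powr:
  assumes p: "p > 0" and int: "integrable unit_lebesgue (\<lambda>x. norm (f x) powr p)"
  shows "ennreal (Lp_norm p f powr p) = (\<integral>\<^sup>+ x. ennreal (norm (f x) powr p) \<partial>unit_lebesgue)"
proof -
  have "Lp_norm p f powr p = integral\<^sup>L unit_lebesgue (\<lambda>x. norm (f x) powr p)"
    unfolding Lp_norm_def using p by (simp add: powr_powr)
  then show ?thesis using nn_integral_eq_integral[OF int] by simp
qed

text \<open>
  By homogeneity, a bound on the unit ball is an inequality for all Haar sums. Since a sum of norm
  zero cannot be normalised, the scaling factor is the norm plus a positive number that is then made
  arbitrarily small.
\<close>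

lemma bounded_rearrangement_iff:
  assumes maps: "\<And>I. I \<in> dyadic_intervals \<Longrightarrow> \<tau> I \<in> dyadic_intervals" and p: "p > 0"
  shows "bounded_rearrangement TYPE('a::banach) \<tau> p \<longleftrightarrow>
    (\<exists>K\<ge>0. \<forall>a :: real set \<Rightarrow> 'a. finitely_supported a \<longrightarrow>
      (\<integral>\<^sup>+ x. ennreal (norm (rearranged_haar_sum \<tau> a x) powr p) \<partial>unit_lebesgue)
      \<le> ennreal K * (\<integral>\<^sup>+ x. ennreal (norm (haar_sum a x) powr p) \<partial>unit_lebesgue))" (is "_ \<longleftrightarrow> ?R")
proof -
  let ?T = "rearranged_haar_sum \<tau> :: (real set \<Rightarrow> 'a) \<Rightarrow> real \<Rightarrow> 'a"
  have LT: "ennreal (Lp_norm p (?T a) powr p) = (\<integral>\<^sup>+ x. ennreal (norm (?T a x) powr p) \<partial>unit_lebesgue)"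
    if "finitely_supported a" for a
    using integrable_rearranged_haar_sum[OF that maps p] by (intro Lp_norm_powr p)
  have LH: "ennreal (Lp_norm p (haar_sum a) powr p) = (\<integral>\<^sup>+ x. ennreal (norm (haar_sum a x) powr p) \<partial>unit_lebesgue)"
    if "finitely_supported a" for a :: "real set \<Rightarrow> 'a"
    using integrable_haar_sum[OF that p] by (intro Lp_norm_powr p)
  show ?thesis
  proof
    assume "bounded_rearrangement TYPE('a) \<tau> p"
    then have "(SUP a \<in> {a :: real set \<Rightarrow> 'a. finitely_supported a \<and> Lp_norm p (haar_sum a) \<le> 1}.
      ennreal (Lp_norm p (?T a))) < \<infinity>"
      unfolding bounded_rearrangement_def .
    then obtain b where b: "(SUP a \<in> {a :: real set \<Rightarrow> 'a. finitely_supported a \<and> Lp_norm p (haar_sum a) \<le> 1}.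
      ennreal (Lp_norm p (?T a))) = ennreal b" "0 \<le> b"
      by (rule less_top_ennreal[THEN iffD1, THEN exE, unfolded infinity_ennreal_def[symmetric]]) blast
    have unit: "Lp_norm p (?T a) \<le> b" if "finitely_supported a" "Lp_norm p (haar_sum a) \<le> 1" for a
    proof -
      have "ennreal (Lp_norm p (?T a)) \<le> ennreal b"
        unfolding b(1)[symmetric] using that by (intro SUP_upper) auto
      then show ?thesis using b(2) by simp
    qed
    have scaled: "Lp_norm p (?T a) \<le> b * Lp_norm p (haar_sum a)" if fs: "finitely_supported a" for a
    proof (rule field_le_epsilon)
      fix e :: real assume e: "0 < e"
      define s where "s = Lp_norm p (haar_sum a) + e / (b + 1)"
      have s: "s > 0" "Lp_norm p (haar_sum a) \<le> s" using e b(2) Lp_norm_nonneg[of p "haar_sum a"]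
        by (auto simp: s_def add_nonneg_pos)
      let ?a = "\<lambda>I. inverse s *\<^sub>R a I"
      have T: "?T ?a = (\<lambda>x. inverse s *\<^sub>R ?T a x)" and H: "haar_sum ?a = (\<lambda>x. inverse s *\<^sub>R haar_sum a x)"
        unfolding haar_sum_eq_rearranged using s by (auto simp: rearranged_haar_sum_scaleR)
      have "finitely_supported ?a" using fs s by (simp add: finitely_supported_def)
      moreover have "Lp_norm p (haar_sum ?a) \<le> 1"
        unfolding H using s p by (simp add: Lp_norm_scaleR field_simps)
      ultimately have "Lp_norm p (?T ?a) \<le> b" by (rule unit)
      then have "inverse s * Lp_norm p (?T a) \<le> b" unfolding T using s p by (simp add: Lp_norm_scaleR)
      then have "Lp_norm p (?T a) \<le> b * s" using s by (simp add: field_simps)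
      also have "\<dots> \<le> b * Lp_norm p (haar_sum a) + e"
        using b(2) e by (simp add: s_def distrib_left field_simps)
      finally show "Lp_norm p (?T a) \<le> b * Lp_norm p (haar_sum a) + e" .
    qed
    show ?R
    proof (intro exI[of _ "b powr p"] conjI allI impI)
      fix a :: "real set \<Rightarrow> 'a" assume fs: "finitely_supported a"
      have "Lp_norm p (?T a) powr p \<le> (b * Lp_norm p (haar_sum a)) powr p"
        using scaled[OF fs] p Lp_norm_nonneg by (intro powr_mono2) auto
      also have "\<dots> = b powr p * Lp_norm p (haar_sum a) powr p"
        using b(2) Lp_norm_nonneg by (intro powr_mult)
      finally have "ennreal (Lp_norm p (?T a) powr p) \<le> ennreal (b powr p) * ennreal (Lp_norm p (haar_sum a) powr p)"
        by (simp add: ennreal_leI flip: ennreal_mult)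
      then show "(\<integral>\<^sup>+ x. ennreal (norm (?T a x) powr p) \<partial>unit_lebesgue)
        \<le> ennreal (b powr p) * (\<integral>\<^sup>+ x. ennreal (norm (haar_sum a x) powr p) \<partial>unit_lebesgue)"
        unfolding LT[OF fs] LH[OF fs] .
    qed simp
  next
    assume ?R
    then obtain K where K: "K \<ge> 0" and bd: "\<And>a :: real set \<Rightarrow> 'a. finitely_supported a \<Longrightarrow>
      (\<integral>\<^sup>+ x. ennreal (norm (?T a x) powr p) \<partial>unit_lebesgue)
      \<le> ennreal K * (\<integral>\<^sup>+ x. ennreal (norm (haar_sum a x) powr p) \<partial>unit_lebesgue)" by blast
    have "Lp_norm p (?T a) \<le> K powr (1 / p)" if fs: "finitely_supported a" and le: "Lp_norm p (haar_sum a) \<le> 1" for a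
    proof -
      have "Lp_norm p (?T a) powr p \<le> K * Lp_norm p (haar_sum a) powr p"
        using bd[OF fs] K unfolding LT[OF fs, symmetric] LH[OF fs, symmetric]
        by (simp flip: ennreal_mult)
      also have "\<dots> \<le> K * 1"
        using K p le by (intro mult_left_mono powr_le1) (auto simp: Lp_norm_nonneg)
      finally have "(Lp_norm p (?T a) powr p) powr (1 / p) \<le> K powr (1 / p)"
        using p by (intro powr_mono2) auto
      then show ?thesis using p Lp_norm_nonneg by (simp add: powr_powr)
    qed
    then have "(SUP a \<in> {a :: real set \<Rightarrow> 'a. finitely_supported a \<and> Lp_norm p (haar_sum a) \<le> 1}.
      ennreal (Lp_norm p (?T a))) \<le> ennreal (K powr (1 / p))"
      by (intro SUP_least ennreal_leI) auto
    then show "bounded_rearrangement TYPE('a) \<tau> p"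
      unfolding bounded_rearrangement_def by (simp add: le_less_trans)
  qed
qed

section \<open>Rearrangements and the measure of unions\<close>

text \<open>
  Values above \<open>t\<close> are compared with the square and values below with \<open>t\<^sup>p\<close>. With \<open>t\<close> free this plays
  the part of Hoelder's inequality between \<open>L\<^sup>p\<close> and \<open>L\<^sup>2\<close> on a set of finite measure.
\<close>

lemma powr_le_square_plus:
  fixes t u p :: real
  assumes "0 < t" "0 \<le> u" "0 < p" "p < 2"
  shows "u powr p \<le> t powr (p - 2) * u\<^sup>2 + t powr p"
proof (cases "u \<le> t")
  case True
  then have "u powr p \<le> t powr p" using assms by (intro powr_mono2) auto
  then show ?thesis by (simp add: add_increasing)
next
  case False
  then have u: "u > 0" using assms by simp
  have "u powr p = u powr (p - 2) * u powr 2" by (simp flip: powr_add)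
  also have "\<dots> \<le> t powr (p - 2) * u powr 2"
    using False assms by (intro mult_right_mono powr_mono2') auto
  finally show ?thesis using u by (simp add: add_increasing2)
qed

text \<open>
  Choose \<open>B' \<subseteq> B\<close> such that the intervals \<open>\<tau>(I)\<close> with \<open>I \<in> B'\<close> are disjoint and cover what \<open>\<tau>\<close> makes of
  \<open>B\<close>, and test the bound on \<open>\<Sum>\<^bsub>I\<in>B'\<^esub> h\<^sub>I\<close>. With \<open>\<sigma> = \<Sum>\<^bsub>I\<in>B'\<^esub> |I|\<close> and \<open>U\<close> the union of \<open>B'\<close> this gives
  \<open>\<sigma> \<le> K (t\<^bsup>p-2\<^esup> \<sigma> + t\<^sup>p |U|)\<close> for every \<open>t > 0\<close>, because \<open>\<sigma>\<close> is both the measure of the covered set and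
  the square of the \<open>L\<^sup>2\<close> norm of the test function. As \<open>p < 2\<close>, the first term is at most
  \<open>\<sigma> / 2\<close> for large \<open>t\<close>.
\<close>

lemma emeasure_Union_image_le:
  fixes \<tau> :: "real set \<Rightarrow> real set" and p K :: real
  assumes maps: "\<And>I. I \<in> dyadic_intervals \<Longrightarrow> \<tau> I \<in> dyadic_intervals"
    and meas: "\<And>I. I \<in> dyadic_intervals \<Longrightarrow> measure lebesgue (\<tau> I) = measure lebesgue I"
    and ex: "\<exists>x :: 'a::banach. x \<noteq> 0" and p: "0 < p" "p < 2" and K: "0 \<le> K"
    and bd: "\<And>a :: real set \<Rightarrow> 'a. finitely_supported a \<Longrightarrow>
      (\<integral>\<^sup>+ x. ennreal (norm (rearranged_haar_sum \<tau> a x) powr p) \<partial>unit_lebesgue)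
      \<le> ennreal K * (\<integral>\<^sup>+ x. ennreal (norm (haar_sum a x) powr p) \<partial>unit_lebesgue)"
  obtains C where "0 \<le> C" "\<And>B. finite B \<Longrightarrow> B \<subseteq> dyadic_intervals \<Longrightarrow>
    emeasure unit_lebesgue (\<Union>(\<tau> ` B)) \<le> ennreal C * emeasure unit_lebesgue (\<Union>B)"
proof
  \<comment> \<open>Chosen for \<open>K t\<^bsup>p-2\<^esup> \<le> 1/2\<close>; the summand \<open>1\<close> keeps \<open>t\<close> positive when \<open>K = 0\<close>.\<close>
  define t where "t = (2 * (K + 1)) powr (1 / (2 - p))"
  have t: "t > 0" using K by (simp add: t_def)
  have "1 / (2 - p) * (p - 2) = - 1" using p by (simp add: field_simps)
  then have "t powr (p - 2) = (2 * (K + 1)) powr - 1"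
    unfolding t_def powr_powr by simp
  then have "t powr (p - 2) = 1 / (2 * (K + 1))"
    using K by (simp add: powr_minus divide_inverse)
  then have "K * t powr (p - 2) = K / (2 * (K + 1))" by simp
  also have "\<dots> \<le> 1 / 2" using K by (simp add: field_simps)
  finally have tp: "K * t powr (p - 2) \<le> 1 / 2" .
  show "0 \<le> 2 * K * t powr p" using K by simp
  obtain e :: 'a where e: "norm e = 1"
  proof -
    obtain x :: 'a where "x \<noteq> 0" using ex ..
    then have "norm (x /\<^sub>R norm x) = 1" by simp
    then show ?thesis using that by blast
  qed
  fix B :: "real set set" assume B: "finite B" "B \<subseteq> dyadic_intervals"
  have \<tau>B: "finite (\<tau> ` B)" "\<tau> ` B \<subseteq> dyadic_intervals" using B maps by auto
  obtain S where S: "S \<subseteq> \<tau> ` B" "disjoint S" "\<Union>S = \<Union>(\<tau> ` B)"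
    using maximal_dyadic_subfamily[OF \<tau>B] .
  obtain B' where B': "B' \<subseteq> B" "inj_on \<tau> B'" "S = \<tau> ` B'"
    using S(1) unfolding subset_image_inj by blast
  have fB': "finite B'" and dB': "B' \<subseteq> dyadic_intervals" using B' B finite_subset by blast+
  have \<tau>B': "finite (\<tau> ` B')" "\<tau> ` B' \<subseteq> dyadic_intervals" using fB' dB' maps by auto
  have disj: "disjoint_family_on \<tau> B'"
    using S(2) inj_onD[OF B'(2)] unfolding B'(3) disjoint_family_on_def
    by (metis disjointD imageI)
  define a where "a I = (if I \<in> B' then e else 0)" for I
  have aB': "{I \<in> dyadic_intervals. a I \<noteq> 0} \<subseteq> B'" by (auto simp: a_def split: if_splits)
  have fs: "finitely_supported a"
    unfolding finitely_supported_def using aB' fB' by (rule finite_subset)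
  have Ta: "rearranged_haar_sum \<tau> a x = (\<Sum>I\<in>B'. haar (\<tau> I) x) *\<^sub>R e" for x
    unfolding rearranged_haar_sum_eq_sum[OF fB' dB' aB', where \<tau>=\<tau> and x=x] by (simp add: a_def scaleR_sum_left)
  have Ha: "haar_sum a x = (\<Sum>I\<in>B'. haar I x) *\<^sub>R e" for x
    unfolding haar_sum_eq_sum[OF fB' dB' aB', where x=x] by (simp add: a_def scaleR_sum_left)
  let ?E = "emeasure unit_lebesgue"
  have sets: "\<tau> ` B' \<subseteq> sets unit_lebesgue"
  proof
    fix J assume "J \<in> \<tau> ` B'"
    then have "J \<in> dyadic_intervals" using \<tau>B' by auto
    then show "J \<in> sets unit_lebesgue" using dyadic_interval_properties by (intro sets_unit_lebesgueI)
  qed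
  \<comment> \<open>\<open>\<tau>\<close> preserves lengths, so the total length of \<open>B'\<close> is the measure of the covered set.\<close>
  have size: "(\<Sum>I\<in>B'. ?E I) = ?E (\<Union>S)"
  proof -
    have "(\<Sum>I\<in>B'. ?E I) = (\<Sum>I\<in>B'. ?E (\<tau> I))"
      using dB' maps meas by (intro sum.cong) (auto simp: emeasure_dyadic subset_iff)
    also have "\<dots> = ?E (\<Union>S)" unfolding B'(3) by (rule sum_emeasure[OF sets disj fB'])
    finally show ?thesis .
  qed
  have one: "\<bar>\<Sum>I\<in>B'. haar (\<tau> I) x\<bar> = 1" if "x \<in> \<Union>S" for x
  proof -
    obtain I where I: "I \<in> B'" "x \<in> \<tau> I" using \<open>x \<in> \<Union>S\<close> B'(3) by blast
    then have "x \<notin> \<tau> J" if "J \<in> B'" "J \<noteq> I" for J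
      using disj that by (auto simp: disjoint_family_on_def)
    then have "(\<Sum>I\<in>B'. haar (\<tau> I) x) = (\<Sum>J\<in>{I}. haar (\<tau> J) x)"
      using I fB' by (intro sum.mono_neutral_right) (auto simp: haar_outside)
    then show ?thesis using I by (simp add: haar_inside)
  qed
  have pw: "\<bar>\<Sum>I\<in>B'. haar I x\<bar> powr p \<le> t powr (p - 2) * (\<Sum>I\<in>B'. haar I x)\<^sup>2 + t powr p * indicator (\<Union>B') x" for x
  proof (cases "x \<in> \<Union>B'")
    case True
    then show ?thesis using powr_le_square_plus[OF t _ p, of "\<bar>\<Sum>I\<in>B'. haar I x\<bar>"] by simp
  next
    case False
    then have "(\<Sum>I\<in>B'. haar I x) = 0" by (intro sum.neutral) (auto simp: haar_outside)
    then show ?thesis using False by simp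
  qed
  have [measurable]: "haar I \<in> borel_measurable unit_lebesgue" if "I \<in> B'" for I
    using simple_function_haar[of I] that dB' by (intro borel_measurable_simple_function) auto
  have UB': "\<Union>B' \<in> sets unit_lebesgue" using Union_dyadic[OF fB' dB'] by simp
  have "?E (\<Union>S) = (\<integral>\<^sup>+ x. indicator (\<Union>S) x \<partial>unit_lebesgue)"
    using Union_dyadic(3)[OF \<tau>B'] B'(3) by simp
  also have "\<dots> \<le> (\<integral>\<^sup>+ x. ennreal (norm (rearranged_haar_sum \<tau> a x) powr p) \<partial>unit_lebesgue)"
    unfolding Ta using one by (intro nn_integral_mono) (auto simp: e split: split_indicator)
  also have "\<dots> \<le> ennreal K * (\<integral>\<^sup>+ x. ennreal (norm (haar_sum a x) powr p) \<partial>unit_lebesgue)"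
    by (rule bd[OF fs])
  also have "\<dots> \<le> ennreal K * (\<integral>\<^sup>+ x. ennreal (t powr (p - 2)) * ennreal ((\<Sum>I\<in>B'. haar I x)\<^sup>2) + ennreal (t powr p) * indicator (\<Union>B') x \<partial>unit_lebesgue)"
  proof (intro mult_left_mono nn_integral_mono)
    fix x
    have "ennreal (\<bar>\<Sum>I\<in>B'. haar I x\<bar> powr p) \<le> ennreal (t powr (p - 2) * (\<Sum>I\<in>B'. haar I x)\<^sup>2 + t powr p * indicator (\<Union>B') x)"
      by (intro ennreal_leI pw)
    also have "\<dots> = ennreal (t powr (p - 2)) * ennreal ((\<Sum>I\<in>B'. haar I x)\<^sup>2) + ennreal (t powr p) * indicator (\<Union>B') x"
      by (subst ennreal_plus) (auto simp: ennreal_mult ennreal_indicator)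
    finally show "ennreal (norm (haar_sum a x) powr p) \<le> ennreal (t powr (p - 2)) * ennreal ((\<Sum>I\<in>B'. haar I x)\<^sup>2) + ennreal (t powr p) * indicator (\<Union>B') x"
      unfolding Ha by (simp add: e)
  qed simp
  also have "\<dots> = ennreal K * (ennreal (t powr (p - 2)) * ?E (\<Union>S) + ennreal (t powr p) * ?E (\<Union>B'))"
    using UB' nn_integral_haar_sum_square[OF fB' dB'] size by (simp add: nn_integral_add nn_integral_cmult)
  finally have main: "?E (\<Union>S) \<le> ennreal K * (ennreal (t powr (p - 2)) * ?E (\<Union>S) + ennreal (t powr p) * ?E (\<Union>B'))" .
  interpret finite_measure unit_lebesgue by (rule finite_measure_unit_lebesgue)
  define s u where "s = measure unit_lebesgue (\<Union>S)" and "u = measure unit_lebesgue (\<Union>B')"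
  have su: "?E (\<Union>S) = ennreal s" "?E (\<Union>B') = ennreal u" "0 \<le> s" "0 \<le> u"
    by (auto simp: s_def u_def emeasure_eq_measure)
  have "ennreal s \<le> ennreal (K * (t powr (p - 2) * s + t powr p * u))"
    using main K su(3,4) unfolding su(1,2) by (simp add: ennreal_mult ennreal_plus)
  then have "s \<le> K * (t powr (p - 2) * s + t powr p * u)"
    using K su(3,4) by (subst (asm) ennreal_le_iff) auto
  also have "\<dots> = (K * t powr (p - 2)) * s + K * t powr p * u" by (simp add: algebra_simps)
  also have "\<dots> \<le> 1 / 2 * s + K * t powr p * u"
    using tp su(3) by (intro add_right_mono mult_right_mono)
  finally have "s \<le> 2 * K * t powr p * u" by simp
  then have "?E (\<Union>S) \<le> ennreal (2 * K * t powr p) * ?E (\<Union>B')"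
    unfolding su using K su(3,4) by (simp add: ennreal_leI flip: ennreal_mult)
  also have "\<dots> \<le> ennreal (2 * K * t powr p) * ?E (\<Union>B)"
    using B' Union_dyadic[OF B] by (intro mult_left_mono emeasure_mono) auto
  finally show "?E (\<Union>(\<tau> ` B)) \<le> ennreal (2 * K * t powr p) * ?E (\<Union>B)"
    unfolding S(3) .
qed

section \<open>Splitting at the maximal function\<close>

text \<open>
  If no interval of \<open>F - S\<close> contains \<open>x\<close>, the sum vanishes. Otherwise let \<open>I\<^sub>0\<close> be the smallest one that
  does, and \<open>C\<close> the half of \<open>I\<^sub>0\<close> that contains \<open>x\<close>. An
  interval that contains \<open>I\<^sub>0\<close> cannot be in \<open>S\<close>, since \<open>S\<close> is inherited by subintervals in \<open>F\<close>. So
  the sum at \<open>x\<close> is the Haar sum truncated at \<open>C\<close>, whose norm is at most the average of \<open>w\<close> over \<open>C\<close>.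
  This average is at most the maximal function, and at most twice the average over \<open>I\<^sub>0\<close>, which does
  not exceed \<open>t\<close> because \<open>I\<^sub>0\<close> is not in \<open>S\<close>.
\<close>

lemma norm_good_part_le:
  fixes a :: "real set \<Rightarrow> 'a::banach" and t :: real
  assumes F: "finite F" "F \<subseteq> dyadic_intervals"
    and G: "finite G" "G \<subseteq> dyadic_intervals" "F \<subseteq> G"
    and child: "\<And>I x. I \<in> F \<Longrightarrow> x \<in> I \<Longrightarrow> \<exists>C\<in>G. x \<in> C \<and> 2 * measure lebesgue C = measure lebesgue I"
    and t: "0 \<le> t"
  defines "w \<equiv> \<lambda>y. norm (\<Sum>I\<in>F. haar I y *\<^sub>R a I)"
  defines "S \<equiv> {J \<in> F. \<exists>K\<in>G. J \<subseteq> K \<and> t * measure lebesgue K < integral K w}"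
  shows "norm (\<Sum>I\<in>F - S. haar I x *\<^sub>R a I) \<le> min (2 * t) (dyadic_maximal G w x)"
proof (cases "{I \<in> F - S. x \<in> I} = {}")
  case True
  then have "(\<Sum>I\<in>F - S. haar I x *\<^sub>R a I) = 0" by (intro sum.neutral) (auto simp: haar_outside)
  then show ?thesis using t dyadic_maximal_nonneg[OF G(1)] by simp
next
  case False
  have int: "w integrable_on K" if "K \<in> dyadic_intervals" for K
    unfolding w_def using F dyadic_interval_properties[OF that]
    by (intro integrable_on_norm_haar_combination[where \<sigma>="\<lambda>I. I"]) auto
  obtain I0 where I0: "I0 \<in> F" "I0 \<notin> S" "x \<in> I0"
    and least: "\<And>I. I \<in> F - S \<Longrightarrow> x \<in> I \<Longrightarrow> measure lebesgue I0 \<le> measure lebesgue I"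
  proof -
    have fin: "finite {I \<in> F - S. x \<in> I}" using F(1) by simp
    show ?thesis
      using that arg_min_if_finite[OF fin False, of "measure lebesgue"]
        arg_min_least[OF fin False, of _ "measure lebesgue"] by blast
  qed
  have dI0: "I0 \<in> dyadic_intervals" using I0 F by blast
  obtain C where C: "C \<in> G" "x \<in> C" and half: "2 * measure lebesgue C = measure lebesgue I0"
    using child[OF I0(1,3)] by blast
  have dC: "C \<in> dyadic_intervals" using C G by blast
  have CI0: "C \<subseteq> I0"
    using half dyadic_measure_pos[OF dC] C(2) I0(3) by (intro dyadic_nested[OF dI0 dC]) auto
  have "(\<Sum>I\<in>F - S. haar I x *\<^sub>R a I)
      = (\<Sum>I | I \<in> F \<and> measure lebesgue C < measure lebesgue I. haar I x *\<^sub>R a I)"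
  proof (rule sum.mono_neutral_cong)
    fix I assume I: "I \<in> {I \<in> F. measure lebesgue C < measure lebesgue I} - (F - S)"
    show "haar I x *\<^sub>R a I = 0"
    proof (rule ccontr)
      assume "haar I x *\<^sub>R a I \<noteq> 0"
      then have x: "x \<in> I" using haar_outside by fastforce
      have "I \<in> dyadic_intervals" using I F by blast
      then have "measure lebesgue I0 \<le> measure lebesgue I"
        using dyadic_measure_double[of I C] I dC half by auto
      then have "I0 \<subseteq> I" using x I0(3) \<open>I \<in> dyadic_intervals\<close> by (intro dyadic_nested dI0) auto
      then show False using I I0 unfolding S_def by blast
    qed
  next
    fix I assume I: "I \<in> (F - S) - {I \<in> F. measure lebesgue C < measure lebesgue I}"
    then have "x \<notin> I" using least[of I] half dyadic_measure_pos[OF dC] by auto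
    then show "haar I x *\<^sub>R a I = 0" by (simp add: haar_outside)
  qed (use F in auto)
  then have le: "measure lebesgue C * norm (\<Sum>I\<in>F - S. haar I x *\<^sub>R a I) \<le> integral C w"
    using norm_truncated_haar_sum_le_integral[OF F dC C(2), of a] unfolding w_def by simp
  have "norm (\<Sum>I\<in>F - S. haar I x *\<^sub>R a I) \<le> integral C w / measure lebesgue C"
    using le dyadic_measure_pos[OF dC] by (simp add: pos_le_divide_eq mult.commute)
  also have "\<dots> \<le> dyadic_maximal G w x"
    using G(1) C by (rule average_le_dyadic_maximal)
  finally have 1: "norm (\<Sum>I\<in>F - S. haar I x *\<^sub>R a I) \<le> dyadic_maximal G w x" .
  have "integral C w \<le> integral I0 w"
    using CI0 int[OF dC] int[OF dI0] by (intro integral_subset_le) (auto simp: w_def)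
  also have "\<dots> \<le> t * measure lebesgue I0"
    using I0 G(3) unfolding S_def by force
  finally have "measure lebesgue C * norm (\<Sum>I\<in>F - S. haar I x *\<^sub>R a I) \<le> measure lebesgue C * (2 * t)"
    using le half by (simp add: mult_ac)
  then have "norm (\<Sum>I\<in>F - S. haar I x *\<^sub>R a I) \<le> 2 * t"
    using dyadic_measure_pos[OF dC] by simp
  with 1 show ?thesis by simp
qed

text \<open>
  The partial sums of a Haar series are averages over halves of the intervals that occur in it, so
  the family behind the maximal function must contain these halves.
\<close>

lemma dyadic_children_family:
  assumes F: "finite F" "F \<subseteq> dyadic_intervals"
  obtains G where "finite G" "G \<subseteq> dyadic_intervals" "F \<subseteq> G"
    "\<And>I x. I \<in> F \<Longrightarrow> x \<in> I \<Longrightarrow> \<exists>C\<in>G. x \<in> C \<and> 2 * measure lebesgue C = measure lebesgue I"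
proof -
  have "\<exists>L R. L \<in> dyadic_intervals \<and> R \<in> dyadic_intervals \<and> I = L \<union> R \<and>
      2 * measure lebesgue L = measure lebesgue I \<and> 2 * measure lebesgue R = measure lebesgue I"
    if "I \<in> dyadic_intervals" for I
    using that by (rule dyadic_halves) blast
  then obtain L R where LR: "\<And>I. I \<in> dyadic_intervals \<Longrightarrow> L I \<in> dyadic_intervals \<and> R I \<in> dyadic_intervals \<and>
      I = L I \<union> R I \<and> 2 * measure lebesgue (L I) = measure lebesgue I \<and> 2 * measure lebesgue (R I) = measure lebesgue I"
    by metis
  show ?thesis
  proof (rule that[of "F \<union> L ` F \<union> R ` F"])
    fix I x assume I: "I \<in> F" and "x \<in> I"
    moreover have "I = L I \<union> R I" using LR[of I] I F by blast
    ultimately consider "x \<in> L I" | "x \<in> R I" by blast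
    then show "\<exists>C\<in>F \<union> L ` F \<union> R ` F. x \<in> C \<and> 2 * measure lebesgue C = measure lebesgue I"
      using LR[of I] I F by cases blast+
  qed (use F LR in auto)
qed

text \<open>
  The Calderon-Zygmund splitting at height \<open>t\<close>. The good part \<open>g\<close> satisfies \<open>\<parallel>g\<parallel> \<le> min (2 t) m\<close>, and
  its image is estimated by Chebyshev's inequality and the bound on \<open>L\<^sup>p\<close>; the bad part is estimated
  only through the measure of the set where its image can be nonzero.
\<close>

lemma rearranged_haar_sum_distribution_le:
  fixes \<tau> :: "real set \<Rightarrow> real set" and p C K t :: real and a :: "real set \<Rightarrow> 'a::banach"
  assumes maps: "\<And>I. I \<in> dyadic_intervals \<Longrightarrow> \<tau> I \<in> dyadic_intervals"
    and p: "0 < p" and K: "0 \<le> K" and C: "0 \<le> C"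
    and bd: "\<And>a :: real set \<Rightarrow> 'a. finitely_supported a \<Longrightarrow>
      (\<integral>\<^sup>+ x. ennreal (norm (rearranged_haar_sum \<tau> a x) powr p) \<partial>unit_lebesgue)
      \<le> ennreal K * (\<integral>\<^sup>+ x. ennreal (norm (haar_sum a x) powr p) \<partial>unit_lebesgue)"
    and supp: "\<And>B. finite B \<Longrightarrow> B \<subseteq> dyadic_intervals \<Longrightarrow>
      emeasure unit_lebesgue (\<Union>(\<tau> ` B)) \<le> ennreal C * emeasure unit_lebesgue (\<Union>B)"
    and F: "finite F" "F \<subseteq> dyadic_intervals" "{I \<in> dyadic_intervals. a I \<noteq> 0} \<subseteq> F"
    and G: "finite G" "G \<subseteq> dyadic_intervals" "F \<subseteq> G"
      "\<And>I x. I \<in> F \<Longrightarrow> x \<in> I \<Longrightarrow> \<exists>C\<in>G. x \<in> C \<and> 2 * measure lebesgue C = measure lebesgue I"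
    and t: "0 < t"
  defines "m \<equiv> dyadic_maximal G (\<lambda>y. norm (haar_sum a y))"
  shows "emeasure unit_lebesgue {x \<in> space unit_lebesgue. t < norm (rearranged_haar_sum \<tau> a x)}
    \<le> ennreal (K * 2 powr p + C) * emeasure unit_lebesgue {x \<in> space unit_lebesgue. t < m x}
      + ennreal K * (\<integral>\<^sup>+ x\<in>{x. m x \<le> t}. ennreal ((m x / t) powr p) \<partial>unit_lebesgue)"
proof -
  let ?E = "emeasure unit_lebesgue"
  define w where "w = (\<lambda>y. norm (\<Sum>I\<in>F. haar I y *\<^sub>R a I))"
  have Hw: "(\<lambda>y. norm (haar_sum a y)) = w" unfolding w_def by (simp add: haar_sum_eq_sum[OF F])
  define S where "S = {J \<in> F. \<exists>K\<in>G. J \<subseteq> K \<and> t * measure lebesgue K < integral K w}"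
  have SF: "S \<subseteq> F" by (auto simp: S_def)
  have S: "finite S" "S \<subseteq> dyadic_intervals" using SF F finite_subset by auto
  have \<tau>S: "finite (\<tau> ` S)" "\<tau> ` S \<subseteq> dyadic_intervals" using S maps by auto
  define g where "g I = (if I \<in> F - S then a I else 0)" for I
  have gF: "{I \<in> dyadic_intervals. g I \<noteq> 0} \<subseteq> F - S" by (auto simp: g_def split: if_splits)
  have FS: "finite (F - S)" "F - S \<subseteq> dyadic_intervals" using F by auto
  have fs: "finitely_supported g"
    unfolding finitely_supported_def using gF FS(1) by (rule finite_subset)
  have Hg: "norm (haar_sum g x) \<le> min (2 * t) (m x)" for x
    using norm_good_part_le[OF F(1,2) G, where t=t and a=a and x=x] t
    unfolding m_def Hw haar_sum_eq_sum[OF FS gF] by (simp add: g_def w_def S_def)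
  have m0: "0 \<le> m x" for x unfolding m_def by (rule dyadic_maximal_nonneg[OF G(1)])
  have [measurable]: "m \<in> borel_measurable unit_lebesgue"
    unfolding m_def by (rule borel_measurable_dyadic_maximal[OF G(1,2)])
  have [measurable]: "(\<lambda>x. norm (rearranged_haar_sum \<tau> g x)) \<in> borel_measurable unit_lebesgue"
    unfolding rearranged_haar_sum_eq_sum[OF FS gF] using FS maps
    by (intro measurable_unit_lebesgueI borel_measurable_norm_haar_combination) auto
  let ?Tg = "{x \<in> space unit_lebesgue. t < norm (rearranged_haar_sum \<tau> g x)}"
  have Tg: "?Tg \<in> sets unit_lebesgue" by measurable
  have "{x \<in> space unit_lebesgue. t < norm (rearranged_haar_sum \<tau> a x)} \<subseteq> ?Tg \<union> \<Union>(\<tau> ` S)"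
  proof
    fix x assume x: "x \<in> {x \<in> space unit_lebesgue. t < norm (rearranged_haar_sum \<tau> a x)}"
    have "rearranged_haar_sum \<tau> a x = rearranged_haar_sum \<tau> g x" if "x \<notin> \<Union>(\<tau> ` S)"
      unfolding rearranged_haar_sum_eq_sum[OF F] rearranged_haar_sum_eq_sum[OF FS gF]
      using F(1) that by (intro sum.mono_neutral_cong_right) (auto simp: g_def haar_outside)
    then show "x \<in> ?Tg \<union> \<Union>(\<tau> ` S)" using x by auto
  qed
  then have "?E {x \<in> space unit_lebesgue. t < norm (rearranged_haar_sum \<tau> a x)} \<le> ?E (?Tg \<union> \<Union>(\<tau> ` S))"
    by (rule emeasure_mono) (rule sets.Un[OF Tg Union_dyadic(3)[OF \<tau>S]])
  also have "\<dots> \<le> ?E ?Tg + ?E (\<Union>(\<tau> ` S))"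
    by (rule emeasure_subadditive[OF Tg Union_dyadic(3)[OF \<tau>S]])
  finally have split: "?E {x \<in> space unit_lebesgue. t < norm (rearranged_haar_sum \<tau> a x)} \<le> ?E ?Tg + ?E (\<Union>(\<tau> ` S))" .

  have "\<Union>S \<subseteq> {x \<in> space unit_lebesgue. t < m x}"
  proof
    fix x assume "x \<in> \<Union>S"
    then obtain J L where J: "x \<in> J" "J \<in> F" and L: "L \<in> G" "J \<subseteq> L" "t * measure lebesgue L < integral L w"
      unfolding S_def by blast
    then have "t < m x"
      unfolding m_def Hw using less_dyadic_maximal_iff[OF G(1,2), of t w x] t by auto
    moreover have "x \<in> {0..<1}" using J F(2) dyadic_subset_unit[of J] by blast
    ultimately show "x \<in> {x \<in> space unit_lebesgue. t < m x}" by simp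
  qed
  then have "?E (\<Union>S) \<le> ?E {x \<in> space unit_lebesgue. t < m x}"
    by (rule emeasure_mono) measurable
  then have bad: "?E (\<Union>(\<tau> ` S)) \<le> ennreal C * ?E {x \<in> space unit_lebesgue. t < m x}"
    using supp[OF S] by (meson mult_left_mono order_trans zero_le)

  have "?E ?Tg = (\<integral>\<^sup>+ x. indicator ?Tg x \<partial>unit_lebesgue)"
    by (rule nn_integral_indicator[OF Tg, symmetric])
  also have "\<dots> \<le> (\<integral>\<^sup>+ x. ennreal (t powr - p) * ennreal (norm (rearranged_haar_sum \<tau> g x) powr p) \<partial>unit_lebesgue)"
  proof (intro nn_integral_mono)
    fix x
    have "1 \<le> t powr - p * norm (rearranged_haar_sum \<tau> g x) powr p" if "t < norm (rearranged_haar_sum \<tau> g x)"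
      using powr_mono2[of p t "norm (rearranged_haar_sum \<tau> g x)"] that t p by (simp add: powr_minus field_simps)
    then show "indicator ?Tg x \<le> ennreal (t powr - p) * ennreal (norm (rearranged_haar_sum \<tau> g x) powr p)"
      by (auto split: split_indicator simp flip: ennreal_mult)
  qed
  also have "\<dots> = ennreal (t powr - p) * (\<integral>\<^sup>+ x. ennreal (norm (rearranged_haar_sum \<tau> g x) powr p) \<partial>unit_lebesgue)"
    by (intro nn_integral_cmult) measurable
  also have "\<dots> \<le> ennreal (t powr - p) * (ennreal K * (\<integral>\<^sup>+ x. ennreal (norm (haar_sum g x) powr p) \<partial>unit_lebesgue))"
    by (intro mult_left_mono bd fs) auto
  also have "\<dots> \<le> ennreal (t powr - p) * (ennreal K * (\<integral>\<^sup>+ x. ennreal (min (2 * t) (m x) powr p) \<partial>unit_lebesgue))"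
    using Hg p by (intro mult_left_mono nn_integral_mono ennreal_leI powr_mono2) auto
  also have "\<dots> = ennreal K * (\<integral>\<^sup>+ x. ennreal (t powr - p) * ennreal (min (2 * t) (m x) powr p) \<partial>unit_lebesgue)"
    by (subst nn_integral_cmult) (auto simp: mult_ac)
  also have "\<dots> \<le> ennreal K * (\<integral>\<^sup>+ x. ennreal (2 powr p) * indicator {x \<in> space unit_lebesgue. t < m x} x
      + ennreal ((m x / t) powr p) * indicator {x. m x \<le> t} x \<partial>unit_lebesgue)"
  proof (intro mult_left_mono nn_integral_mono)
    fix x assume x: "x \<in> space unit_lebesgue"
    show "ennreal (t powr - p) * ennreal (min (2 * t) (m x) powr p) \<le> ennreal (2 powr p) * indicator {x \<in> space unit_lebesgue. t < m x} x
      + ennreal ((m x / t) powr p) * indicator {x. m x \<le> t} x"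
    proof (cases "t < m x")
      case True
      have "t powr - p * min (2 * t) (m x) powr p \<le> t powr - p * (2 * t) powr p"
        using p t m0[of x] by (intro mult_left_mono powr_mono2) auto
      also have "\<dots> = 2 powr p" using t by (simp add: powr_mult powr_minus)
      finally show ?thesis using True x by (simp add: ennreal_leI flip: ennreal_mult)
    next
      case False
      then have "t powr - p * min (2 * t) (m x) powr p = (m x / t) powr p"
        using t m0[of x] by (simp add: powr_divide powr_minus_divide)
      then show ?thesis using False by (simp flip: ennreal_mult)
    qed
  qed simp
  also have "\<dots> = ennreal K * (ennreal (2 powr p) * ?E {x \<in> space unit_lebesgue. t < m x}
      + (\<integral>\<^sup>+ x\<in>{x. m x \<le> t}. ennreal ((m x / t) powr p) \<partial>unit_lebesgue))"
    by (subst nn_integral_add) (measurable, subst nn_integral_cmult_indicator, measurable)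
  finally have good: "?E ?Tg \<le> ennreal K * (ennreal (2 powr p) * ?E {x \<in> space unit_lebesgue. t < m x}
      + (\<integral>\<^sup>+ x\<in>{x. m x \<le> t}. ennreal ((m x / t) powr p) \<partial>unit_lebesgue))" .
  have "ennreal (K * 2 powr p + C) = ennreal K * ennreal (2 powr p) + ennreal C"
    using K C by (simp add: ennreal_mult)
  then show ?thesis
    using order_trans[OF split add_mono[OF good bad]] by (simp add: algebra_simps)
qed

section \<open>Extrapolation\<close>

theorem corollary5p7:
  fixes \<tau> :: "real set \<Rightarrow> real set" and p q :: real
  assumes "\<exists>x :: 'a::complex_banach. x \<noteq> 0"
    and "bij_betw \<tau> dyadic_intervals dyadic_intervals"
    and "\<And>I. I \<in> dyadic_intervals \<Longrightarrow> measure lebesgue (\<tau> I) = measure lebesgue I"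
    and "1 < q" and "q < p" and "p < 2"
    and "bounded_rearrangement TYPE('a) \<tau> p"
  shows "bounded_rearrangement TYPE('a) \<tau> q"
proof -
  have maps: "\<tau> I \<in> dyadic_intervals" if "I \<in> dyadic_intervals" for I
    using assms(2) that by (rule bij_betw_apply)
  obtain K where K: "0 \<le> K" and bd: "\<And>a :: real set \<Rightarrow> 'a. finitely_supported a \<Longrightarrow>
      (\<integral>\<^sup>+ x. ennreal (norm (rearranged_haar_sum \<tau> a x) powr p) \<partial>unit_lebesgue)
      \<le> ennreal K * (\<integral>\<^sup>+ x. ennreal (norm (haar_sum a x) powr p) \<partial>unit_lebesgue)"
    using assms(4,5,7) bounded_rearrangement_iff[of \<tau> p, OF maps] by auto
  obtain C where C: "0 \<le> C" and supp: "\<And>B. finite B \<Longrightarrow> B \<subseteq> dyadic_intervals \<Longrightarrow>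
      emeasure unit_lebesgue (\<Union>(\<tau> ` B)) \<le> ennreal C * emeasure unit_lebesgue (\<Union>B)"
    using emeasure_Union_image_le[of \<tau> p K, OF maps assms(3,1) _ assms(6) K bd] assms(4,5) by auto
  define c where "c = K * 2 powr p + C + K * (q / (p - q))"
  have c: "0 \<le> c" using K C assms(5) assms(4) by (simp add: c_def)
  define d where "d = (2 * q / (q - 1)) powr q"
  have "(\<integral>\<^sup>+ x. ennreal (norm (rearranged_haar_sum \<tau> a x) powr q) \<partial>unit_lebesgue)
      \<le> ennreal (c * d) * (\<integral>\<^sup>+ x. ennreal (norm (haar_sum a x) powr q) \<partial>unit_lebesgue)"
    if a: "finitely_supported a" for a :: "real set \<Rightarrow> 'a"
  proof -
    interpret finite_measure unit_lebesgue by (rule finite_measure_unit_lebesgue)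
    define F where "F = {I \<in> dyadic_intervals. a I \<noteq> 0}"
    have F: "finite F" "F \<subseteq> dyadic_intervals" "{I \<in> dyadic_intervals. a I \<noteq> 0} \<subseteq> F"
      using a by (auto simp: F_def finitely_supported_def)
    obtain G where G: "finite G" "G \<subseteq> dyadic_intervals" "F \<subseteq> G"
      "\<And>I x. I \<in> F \<Longrightarrow> x \<in> I \<Longrightarrow> \<exists>C\<in>G. x \<in> C \<and> 2 * measure lebesgue C = measure lebesgue I"
      using dyadic_children_family[OF F(1,2)] by metis
    let ?w = "\<lambda>y. norm (haar_sum a y)"
    have w: "?w \<in> borel_measurable borel"
      unfolding haar_sum_eq_sum[OF F] using F borel_measurable_norm_haar_combination[of F "\<lambda>I. I" a] by auto
    have Tm: "(\<lambda>x. norm (rearranged_haar_sum \<tau> a x)) \<in> borel_measurable borel"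
      unfolding rearranged_haar_sum_eq_sum[OF F] using F maps borel_measurable_norm_haar_combination[of F \<tau> a] by auto
    have int: "?w integrable_on L" if "L \<in> G" for L
      unfolding haar_sum_eq_sum[OF F] using F G dyadic_lmeasurable that
      by (intro integrable_on_norm_haar_combination[where \<sigma>="\<lambda>I. I"]) auto
    have "(\<integral>\<^sup>+ x. ennreal (norm (rearranged_haar_sum \<tau> a x) powr q) \<partial>unit_lebesgue)
      \<le> ennreal c * (\<integral>\<^sup>+ x. ennreal (dyadic_maximal G ?w x powr q) \<partial>unit_lebesgue)"
      unfolding c_def
    proof (rule nn_integral_powr_le_of_distribution_bound)
      show "emeasure unit_lebesgue {x \<in> space unit_lebesgue. t < norm (rearranged_haar_sum \<tau> a x)}
        \<le> ennreal (K * 2 powr p + C) * emeasure unit_lebesgue {x \<in> space unit_lebesgue. t < dyadic_maximal G ?w x}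
          + ennreal K * (\<integral>\<^sup>+ x\<in>{x. dyadic_maximal G ?w x \<le> t}. ennreal ((dyadic_maximal G ?w x / t) powr p) \<partial>unit_lebesgue)"
        if "0 < t" for t
        using assms(4,5) that
        by (intro rearranged_haar_sum_distribution_le[OF maps _ K C bd supp F G]) auto
    qed (use assms(4,5) K C Tm borel_measurable_dyadic_maximal[OF G(1,2)] dyadic_maximal_nonneg[OF G(1)]
        in \<open>auto intro: measurable_unit_lebesgueI\<close>)
    also have "\<dots> \<le> ennreal c * (ennreal d * (\<integral>\<^sup>+ x. ennreal (?w x powr q) \<partial>unit_lebesgue))"
      unfolding d_def using assms(4) w int G
      by (intro mult_left_mono dyadic_maximal_powr_integral_le) (auto intro: measurable_unit_lebesgueI)
    finally show ?thesis using c by (simp add: ennreal_mult d_def mult.assoc)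
  qed
  moreover have "0 \<le> c * d" using c by (simp add: d_def)
  ultimately show ?thesis
    using bounded_rearrangement_iff[of \<tau> q, OF maps] assms(4) by auto
qed

end
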